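(* Let $1\le p<\infty$ and let $T$ be a strictly cyclic quasinilpotent forward unilateral weighted shift on $\ell^p(\mathbb{N})$. Then $\Lambda(T)=\{1\}$.
   Context: $\ell^p(\mathbb{N})$ is the complex Banach space of $p$-summable complex sequences indexed by $\mathbb{N}=\{0,1,2,\dots\}$, with canonical basis $\{e_n\}_{n=0}^\infty$. A forward unilateral weighted shift on $\ell^p(\mathbb{N})$ with weight sequence $\{w_n\}_{n=0}^\infty$ is a bounded linear operator $T$ with $Te_n=w_ne_{n+1}$ for all $n\ge 0$. A bounded operator $T$ on a Banach space $X$ is strictly cyclic if there is a vector $x_0\in X$ such that $\{Ax_0: A\in\mathcal{A}(T)\}=X$, where $\mathcal{A}(T)$ is the subalgebra of bounded operators generated by $I$ and $T$ and closed in the weak operator topology. A bounded operator $T$ on a complex Banach space $X$ is quasinilpotent if its spectrum is $\{0\}$. For quasinilpotent $T$ and $x\in X\setminus\{0\}$, $$k_x=k_{(T,x)}=\limsup_{z\to 0}\frac{\ln\|(z-T)^{-1}x\|}{\ln\|(z-T)^{-1}\|}$$ ($z\in\mathbb{C}\setminus\{0\}$), and the power set of $T$ is $\Lambda(T)=\{k_x: x\in X\setminus\{0\}\}$. *)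

theory Defs
  imports "HOL-Analysis.Analysis" "HOL-Library.FuncSet"
begin

text \<open>
  The exponent \<open>p\<close> is a term-level parameter, so \<open>\<ell>\<^sup>p(\<nat>)\<close> is a set of sequences with pointwise
  operations, and operators on it are functions that are \<^const>\<open>extensional\<close> on that set: this makes
  equality of functions coincide with equality of operators.
\<close>

definition lp :: "real \<Rightarrow> (nat \<Rightarrow> complex) set" where
  "lp p = {x. summable (\<lambda>n. norm (x n) powr p)}"

definition lp_norm :: "real \<Rightarrow> (nat \<Rightarrow> complex) \<Rightarrow> real" where
  "lp_norm p x = (\<Sum>n. norm (x n) powr p) powr (1 / p)"

definition basis_vec :: "nat \<Rightarrow> nat \<Rightarrow> complex" where
  "basis_vec n = (\<lambda>k. if k = n then 1 else 0)"

definition bounded_ops :: "real \<Rightarrow> ((nat \<Rightarrow> complex) \<Rightarrow> (nat \<Rightarrow> complex)) set" where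
  "bounded_ops p = {A \<in> lp p \<rightarrow>\<^sub>E lp p.
     (\<forall>x\<in>lp p. \<forall>y\<in>lp p. A (\<lambda>n. x n + y n) = (\<lambda>n. A x n + A y n)) \<and>
     (\<forall>c. \<forall>x\<in>lp p. A (\<lambda>n. c * x n) = (\<lambda>n. c * A x n)) \<and>
     (\<exists>C. \<forall>x\<in>lp p. lp_norm p (A x) \<le> C * lp_norm p x)}"

definition bounded_functionals :: "real \<Rightarrow> ((nat \<Rightarrow> complex) \<Rightarrow> complex) set" where
  "bounded_functionals p = {\<phi> \<in> extensional (lp p).
     (\<forall>x\<in>lp p. \<forall>y\<in>lp p. \<phi> (\<lambda>n. x n + y n) = \<phi> x + \<phi> y) \<and>
     (\<forall>c. \<forall>x\<in>lp p. \<phi> (\<lambda>n. c * x n) = c * \<phi> x) \<and>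
     (\<exists>C. \<forall>x\<in>lp p. norm (\<phi> x) \<le> C * lp_norm p x)}"

definition op_norm :: "real \<Rightarrow> ((nat \<Rightarrow> complex) \<Rightarrow> (nat \<Rightarrow> complex)) \<Rightarrow> real" where
  "op_norm p A = (SUP x\<in>{x\<in>lp p. lp_norm p x \<le> 1}. lp_norm p (A x))"

definition op_id :: "real \<Rightarrow> (nat \<Rightarrow> complex) \<Rightarrow> (nat \<Rightarrow> complex)" where
  "op_id p = (\<lambda>x\<in>lp p. x)"

definition op_add :: "real \<Rightarrow> ((nat \<Rightarrow> complex) \<Rightarrow> (nat \<Rightarrow> complex)) \<Rightarrow>
    ((nat \<Rightarrow> complex) \<Rightarrow> (nat \<Rightarrow> complex)) \<Rightarrow> (nat \<Rightarrow> complex) \<Rightarrow> (nat \<Rightarrow> complex)" where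
  "op_add p A B = (\<lambda>x\<in>lp p. \<lambda>n. A x n + B x n)"

definition op_scale :: "real \<Rightarrow> complex \<Rightarrow> ((nat \<Rightarrow> complex) \<Rightarrow> (nat \<Rightarrow> complex)) \<Rightarrow>
    (nat \<Rightarrow> complex) \<Rightarrow> (nat \<Rightarrow> complex)" where
  "op_scale p c A = (\<lambda>x\<in>lp p. \<lambda>n. c * A x n)"

text \<open>The coarsest topology on the bounded operators making every \<open>A \<mapsto> \<phi> (A x)\<close> continuous.\<close>

definition weak_operator_topology ::
    "real \<Rightarrow> ((nat \<Rightarrow> complex) \<Rightarrow> (nat \<Rightarrow> complex)) topology" where
  "weak_operator_topology p = topology_generated_by
     {{A \<in> bounded_ops p. \<phi> (A x) \<in> U} | \<phi> x U. \<phi> \<in> bounded_functionals p \<and> x \<in> lp p \<and> open U}"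

definition op_subalgebra :: "real \<Rightarrow> ((nat \<Rightarrow> complex) \<Rightarrow> (nat \<Rightarrow> complex)) set \<Rightarrow> bool" where
  "op_subalgebra p S \<longleftrightarrow> S \<subseteq> bounded_ops p \<and> S \<noteq> {} \<and>
     (\<forall>A\<in>S. \<forall>B\<in>S. op_add p A B \<in> S) \<and>
     (\<forall>c. \<forall>A\<in>S. op_scale p c A \<in> S) \<and>
     (\<forall>A\<in>S. \<forall>B\<in>S. compose (lp p) A B \<in> S)"

definition wot_closed_algebra :: "real \<Rightarrow> ((nat \<Rightarrow> complex) \<Rightarrow> (nat \<Rightarrow> complex)) \<Rightarrow>
    ((nat \<Rightarrow> complex) \<Rightarrow> (nat \<Rightarrow> complex)) set" where
  "wot_closed_algebra p T = \<Inter>{S. op_subalgebra p S \<and> op_id p \<in> S \<and> T \<in> S \<and>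
     closedin (weak_operator_topology p) S}"

definition strictly_cyclic :: "real \<Rightarrow> ((nat \<Rightarrow> complex) \<Rightarrow> (nat \<Rightarrow> complex)) \<Rightarrow> bool" where
  "strictly_cyclic p T \<longleftrightarrow> (\<exists>x\<^sub>0\<in>lp p. {A x\<^sub>0 | A. A \<in> wot_closed_algebra p T} = lp p)"

definition forward_weighted_shift ::
    "real \<Rightarrow> (nat \<Rightarrow> complex) \<Rightarrow> ((nat \<Rightarrow> complex) \<Rightarrow> (nat \<Rightarrow> complex)) \<Rightarrow> bool" where
  "forward_weighted_shift p w T \<longleftrightarrow> T \<in> bounded_ops p \<and>
     (\<forall>n. T (basis_vec n) = (\<lambda>k. w n * basis_vec (n + 1) k))"

definition shifted :: "real \<Rightarrow> ((nat \<Rightarrow> complex) \<Rightarrow> (nat \<Rightarrow> complex)) \<Rightarrow> complex \<Rightarrow>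
    (nat \<Rightarrow> complex) \<Rightarrow> (nat \<Rightarrow> complex)" where
  "shifted p T z = (\<lambda>x\<in>lp p. \<lambda>n. z * x n - T x n)"

definition op_inverse :: "real \<Rightarrow> ((nat \<Rightarrow> complex) \<Rightarrow> (nat \<Rightarrow> complex)) \<Rightarrow>
    ((nat \<Rightarrow> complex) \<Rightarrow> (nat \<Rightarrow> complex)) \<Rightarrow> bool" where
  "op_inverse p A R \<longleftrightarrow> R \<in> bounded_ops p \<and>
     compose (lp p) A R = op_id p \<and> compose (lp p) R A = op_id p"

definition op_spectrum :: "real \<Rightarrow> ((nat \<Rightarrow> complex) \<Rightarrow> (nat \<Rightarrow> complex)) \<Rightarrow> complex set" where
  "op_spectrum p T = {z. \<not> (\<exists>R. op_inverse p (shifted p T z) R)}"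

definition resolvent :: "real \<Rightarrow> ((nat \<Rightarrow> complex) \<Rightarrow> (nat \<Rightarrow> complex)) \<Rightarrow> complex \<Rightarrow>
    (nat \<Rightarrow> complex) \<Rightarrow> (nat \<Rightarrow> complex)" where
  "resolvent p T z = (THE R. op_inverse p (shifted p T z) R)"

definition quasinilpotent :: "real \<Rightarrow> ((nat \<Rightarrow> complex) \<Rightarrow> (nat \<Rightarrow> complex)) \<Rightarrow> bool" where
  "quasinilpotent p T \<longleftrightarrow> T \<in> bounded_ops p \<and> op_spectrum p T = {0}"

text \<open>The limsup is taken in the extended reals; the filter \<^term>\<open>at 0\<close> excludes \<open>z = 0\<close>.\<close>

definition local_exponent ::
    "real \<Rightarrow> ((nat \<Rightarrow> complex) \<Rightarrow> (nat \<Rightarrow> complex)) \<Rightarrow> (nat \<Rightarrow> complex) \<Rightarrow> ereal" where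
  "local_exponent p T x = Limsup (at (0::complex))
     (\<lambda>z. ereal (ln (lp_norm p (resolvent p T z x)) / ln (op_norm p (resolvent p T z))))"

text \<open>The power set \<open>\<Lambda>(T)\<close>, unrelated to \<^const>\<open>Pow\<close>.\<close>

definition power_set :: "real \<Rightarrow> ((nat \<Rightarrow> complex) \<Rightarrow> (nat \<Rightarrow> complex)) \<Rightarrow> ereal set" where
  "power_set p T = {local_exponent p T x | x. x \<in> lp p \<and> x \<noteq> (\<lambda>_. 0)}"

end

theory Submission
  imports Defs
begin

text \<open>
  Write \<open>R(z) = (z - T)\<inverse>\<close> and let \<open>e\<^sub>n\<close> be the basis vectors.  The upper bound \<open>k\<^sub>x \<le> 1\<close> is immediate
  from \<open>\<parallel>R(z) x\<parallel> \<le> \<parallel>R(z)\<parallel> \<parallel>x\<parallel>\<close> and \<open>\<parallel>R(z)\<parallel> \<rightarrow> \<infinity>\<close>.  For the lower bound, \<open>\<parallel>R(z) e\<^sub>0\<parallel>\<close> is compared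
  with both \<open>\<parallel>R(z)\<parallel>\<close> and \<open>\<parallel>R(z) x\<parallel>\<close>.

  The tool for both comparisons is rotation.  For \<open>\<bar>u\<bar> = 1\<close> let \<open>U\<^sub>u e\<^sub>n = u\<^sup>n e\<^sub>n\<close>.  Conjugating a weighted
  shift by \<open>U\<^sub>u\<close> multiplies it by \<open>u\<close>, so \<open>\<parallel>R(z) U\<^sub>u x\<parallel> = \<parallel>R(z u) x\<parallel>\<close>, and averaging over \<open>u\<close>
  extracts a coordinate from a vector, or the diagonal from a matrix (\<open>norm_diagonal_le\<close>).

  \<^bold>\<open>Comparison with the operator norm\<close> (\<open>op_norm_R_le\<close>).  Let \<open>x\<^sub>0\<close> be strictly cyclic.
  For every \<open>y\<close> there is \<open>M\<^sub>y \<in> \<A>(T)\<close> with \<open>M\<^sub>y x\<^sub>0 = y\<close>.  As \<open>\<A>(T)\<close> lies in the double commutant of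
  \<open>T\<close>, it is commutative and commutes with \<open>R(z)\<close>; hence \<open>M\<^sub>y u = M\<^sub>u y\<close>, and the uniform boundedness
  principle gives \<open>\<parallel>M\<^sub>y u\<parallel> \<le> C \<parallel>y\<parallel> \<parallel>u\<parallel>\<close>.  Put \<open>A = M\<^sub>y\<close> with \<open>y = e\<^sub>0\<close>.  Then
  \<open>R(z) A v = R(z) M\<^sub>v e\<^sub>0 = M\<^sub>v R(z) e\<^sub>0\<close>, so \<open>\<parallel>R(z) A v\<parallel> \<le> C \<parallel>v\<parallel> \<parallel>R(z) e\<^sub>0\<parallel>\<close>.  Formally \<open>A\<close> is a
  power series in \<open>T\<close> with constant term \<open>a \<noteq> 0\<close>, so its matrix has constant diagonal \<open>a\<close>; averaging the
  last estimate over rotations replaces \<open>A\<close> by \<open>a\<close> and yields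
  \<open>\<bar>a\<bar> \<parallel>R(z) v\<parallel> \<le> C \<parallel>v\<parallel> \<parallel>R(z) e\<^sub>0\<parallel>\<close>.

  \<^bold>\<open>Comparison with a given vector\<close> (\<open>R_large_on_circle\<close>, \<open>norm_R_basis_vec_ge\<close>).
  If \<open>x\<close> has a nonzero coordinate \<open>x\<^sub>m\<close>, averaging \<open>U\<^sub>u x\<close> shows that \<open>\<parallel>R(z) x\<parallel>\<close> somewhere on each circle
  about \<open>0\<close> is at least a constant times \<open>\<parallel>R(z) e\<^sub>m\<parallel>\<close>.  Since \<open>e\<^sub>m\<close> is a multiple of \<open>T\<^sup>m e\<^sub>0\<close> and
  \<open>T R(z) = z R(z) - 1\<close>, this is in turn at least \<open>c \<bar>z\<bar>\<^sup>m \<parallel>R(z) e\<^sub>0\<parallel> - D\<close>.  The factor \<open>\<bar>z\<bar>\<^sup>m\<close> is harmless on the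
  logarithmic scale: no weight vanishes, so the \<open>n\<close>-th coordinate of \<open>R(z) e\<^sub>0\<close> is a nonzero constant times
  \<open>z\<^sup>-\<^sup>n\<^sup>-\<^sup>1\<close> for every \<open>n\<close>, and \<open>ln \<parallel>R(z) e\<^sub>0\<parallel>\<close> dominates every multiple of \<open>ln (1/\<bar>z\<bar>)\<close>.
\<close>

section \<open>The norm of \<open>\<ell>\<^sup>p\<close>\<close>

text \<open>The standing assumption \<open>1 \<le> p\<close> is what makes \<^const>\<open>lp_norm\<close> a norm.\<close>

locale lp_exponent =
  fixes p :: real
  assumes p1: "1 \<le> p"
begin

lemma lp_norm_nonneg: "0 \<le> lp_norm p x"
  by (simp add: lp_norm_def)

lemma lp_norm_powr:
  assumes "x \<in> lp p"
  shows "lp_norm p x powr p = (\<Sum>n. norm (x n) powr p)"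
proof -
  have "0 \<le> (\<Sum>n. norm (x n) powr p)"
    using assms by (intro suminf_nonneg) (auto simp: lp_def)
  then show ?thesis using p1 by (simp add: lp_norm_def powr_powr)
qed

lemma lp_partial_sum_le:
  assumes "x \<in> lp p" "finite I"
  shows "(\<Sum>n\<in>I. norm (x n) powr p) \<le> lp_norm p x powr p"
  unfolding lp_norm_powr[OF assms(1)] using assms
  by (intro sum_le_suminf) (auto simp: lp_def)

lemma lp_normI:
  assumes "0 \<le> K" and "\<And>N. (\<Sum>n<N. norm (x n) powr p) \<le> K powr p"
  shows "x \<in> lp p" and "lp_norm p x \<le> K"
proof -
  have s: "summable (\<lambda>n. norm (x n) powr p)"
    by (rule summableI_nonneg_bounded[of _ "K powr p"]) (use assms in auto)
  then show "x \<in> lp p" by (simp add: lp_def)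
  have "(\<Sum>n. norm (x n) powr p) \<le> K powr p"
    by (rule suminf_le_const[OF s assms(2)])
  then have "lp_norm p x \<le> (K powr p) powr (1/p)"
    unfolding lp_norm_def using s p1 by (intro powr_mono2 suminf_nonneg) auto
  then show "lp_norm p x \<le> K" using p1 assms(1) by (simp add: powr_powr)
qed

lemma lp_coord_le:
  assumes "x \<in> lp p" shows "norm (x n) \<le> lp_norm p x"
proof -
  have "norm (x n) powr p \<le> lp_norm p x powr p"
    using lp_partial_sum_le[OF assms, of "{n}"] by simp
  then show ?thesis using p1 lp_norm_nonneg[of x]
    by (metis norm_ge_zero not_le powr_less_mono2 less_le_trans zero_less_one)
qed

lemma lp_mono:
  assumes "x \<in> lp p" "\<And>n. norm (y n) \<le> norm (x n)"
  shows "y \<in> lp p" and "lp_norm p y \<le> lp_norm p x"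
proof -
  have *: "(\<Sum>n<N. norm (y n) powr p) \<le> lp_norm p x powr p" for N
  proof -
    have "(\<Sum>n<N. norm (y n) powr p) \<le> (\<Sum>n<N. norm (x n) powr p)"
      using assms(2) p1 by (intro sum_mono powr_mono2) auto
    also have "\<dots> \<le> lp_norm p x powr p" using lp_partial_sum_le[OF assms(1)] by simp
    finally show ?thesis .
  qed
  from lp_normI[OF lp_norm_nonneg *] show "y \<in> lp p" "lp_norm p y \<le> lp_norm p x" by auto
qed

lemma lp_norm_cong_norm:
  assumes "\<And>n. norm (y n) = norm (x n)"
  shows "y \<in> lp p \<longleftrightarrow> x \<in> lp p" and "lp_norm p y = lp_norm p x"
  using assms by (simp_all add: lp_def lp_norm_def)

lemma lp_zero: "(\<lambda>_. 0) \<in> lp p" "lp_norm p (\<lambda>_. 0) = 0"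
  by (simp_all add: lp_def lp_norm_def)

lemma lp_norm_eq_0_iff:
  assumes "x \<in> lp p" shows "lp_norm p x = 0 \<longleftrightarrow> x = (\<lambda>_. 0)"
  using lp_coord_le[OF assms] lp_zero by fastforce

lemma lp_norm_pos:
  assumes "x \<in> lp p" "x \<noteq> (\<lambda>_. 0)" shows "0 < lp_norm p x"
  using lp_norm_eq_0_iff[OF assms(1)] assms(2) lp_norm_nonneg[of x] by linarith

lemma lp_scale:
  assumes "x \<in> lp p"
  shows "(\<lambda>n. c * x n) \<in> lp p" and "lp_norm p (\<lambda>n. c * x n) = norm c * lp_norm p x"
proof -
  have s: "summable (\<lambda>n. norm (x n) powr p)" using assms by (simp add: lp_def)
  have e: "norm (c * x n) powr p = norm c powr p * norm (x n) powr p" for n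
    by (simp add: norm_mult powr_mult)
  show "(\<lambda>n. c * x n) \<in> lp p" unfolding lp_def mem_Collect_eq e
    using s by (rule summable_mult)
  show "lp_norm p (\<lambda>n. c * x n) = norm c * lp_norm p x"
    unfolding lp_norm_def e suminf_mult[OF s]
    using p1 s by (subst powr_mult) (auto simp: powr_powr intro!: suminf_nonneg)
qed

text \<open>Convexity of \<open>t \<mapsto> t\<^sup>p\<close> on the closed half-line; the endpoint \<open>0\<close> needs \<open>a\<^sup>p \<le> a\<close> for \<open>a \<le> 1\<close>.\<close>

lemma powr_convex_combination:
  assumes "0 \<le> s" "0 \<le> t" "0 \<le> a" "0 \<le> b" "a + b = (1::real)"
  shows "(a * s + b * t) powr p \<le> a * s powr p + b * t powr p"
proof -
  have le: "u powr p \<le> u" if "0 \<le> u" "u \<le> 1" for u :: real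
    using powr_mono'[of 1 p u] that p1 by (cases "u = 0") auto
  have z: "(c * r) powr p \<le> c * r powr p" if "0 \<le> c" "c \<le> 1" "0 \<le> r" for c r :: real
    using that le[of c] by (simp add: powr_mult mult_right_mono)
  show ?thesis
  proof (cases "s = 0 \<or> t = 0")
    case True
    then show ?thesis using z[of a s] z[of b t] assms by auto
  next
    case False
    then show ?thesis using convex_onD[OF powr_convex[OF p1], of b s t] assms
      by (simp add: eq_diff_eq[symmetric])
  qed
qed

text \<open>Minkowski's inequality.  With \<open>a = \<parallel>x\<parallel>\<close> and \<open>b = \<parallel>y\<parallel>\<close>, the sum \<open>\<bar>x\<^sub>n\<bar> + \<bar>y\<^sub>n\<bar>\<close> is \<open>a + b\<close> times the
  convex combination of \<open>\<bar>x\<^sub>n\<bar> / a\<close> and \<open>\<bar>y\<^sub>n\<bar> / b\<close> with weights proportional to \<open>a\<close> and \<open>b\<close>; apply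
  convexity of \<open>t \<mapsto> t\<^sup>p\<close> in each coordinate and sum.\<close>

lemma lp_add:
  assumes x: "x \<in> lp p" and y: "y \<in> lp p"
  shows "(\<lambda>n. x n + y n) \<in> lp p" and "lp_norm p (\<lambda>n. x n + y n) \<le> lp_norm p x + lp_norm p y"
proof -
  define a b where "a = lp_norm p x" and "b = lp_norm p y"
  have ab: "0 \<le> a" "0 \<le> b" by (simp_all add: a_def b_def lp_norm_nonneg)
  have key: "(\<lambda>n. x n + y n) \<in> lp p \<and> lp_norm p (\<lambda>n. x n + y n) \<le> a + b"
  proof (cases "a = 0 \<or> b = 0")
    case True
    then have "x = (\<lambda>_. 0) \<or> y = (\<lambda>_. 0)"
      using lp_norm_eq_0_iff x y a_def b_def by auto
    then show ?thesis using x y ab a_def b_def by auto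
  next
    case False
    then have pos: "0 < a" "0 < b" using ab by auto
    define u v where "u = a / (a + b)" and "v = b / (a + b)"
    have uv: "0 \<le> u" "0 \<le> v" "u + v = 1"
      using pos by (auto simp: u_def v_def add_divide_distrib[symmetric])
    have term_le: "norm (x n + y n) powr p \<le> (a + b) powr p *
        (u * (norm (x n) powr p / a powr p) + v * (norm (y n) powr p / b powr p))" for n
    proof -
      have "norm (x n + y n) powr p \<le> (norm (x n) + norm (y n)) powr p"
        using p1 by (intro powr_mono2 norm_triangle_ineq) auto
      also have "norm (x n) + norm (y n) = (a + b) * (u * (norm (x n) / a) + v * (norm (y n) / b))"
      proof -
        have "(a + b) * u = a" "(a + b) * v = b" using pos by (simp_all add: u_def v_def)
        then show ?thesis using pos
          by (simp add: distrib_left mult.assoc[symmetric] del: times_divide_eq_left times_divide_eq_right) simp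
      qed
      also have "\<dots> powr p = (a + b) powr p * (u * (norm (x n) / a) + v * (norm (y n) / b)) powr p"
        by (rule powr_mult)
      also have "\<dots> \<le> (a + b) powr p * (u * (norm (x n) / a) powr p + v * (norm (y n) / b) powr p)"
        using pos uv by (intro mult_left_mono powr_convex_combination) auto
      finally show ?thesis using pos by (simp add: powr_divide)
    qed
    have "(\<Sum>n<N. norm (x n + y n) powr p) \<le> (a + b) powr p" for N
    proof -
      have "(\<Sum>n<N. norm (x n + y n) powr p) \<le> (\<Sum>n<N. (a + b) powr p *
        (u * (norm (x n) powr p / a powr p) + v * (norm (y n) powr p / b powr p)))"
        by (intro sum_mono term_le)
      also have "\<dots> = (a + b) powr p * (u * ((\<Sum>n<N. norm (x n) powr p) / a powr p)
          + v * ((\<Sum>n<N. norm (y n) powr p) / b powr p))"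
        by (simp only: sum_distrib_left[symmetric] sum.distrib sum_divide_distrib[symmetric])
      also have "\<dots> \<le> (a + b) powr p * (u * 1 + v * 1)"
        using pos uv lp_partial_sum_le[OF x, of "{..<N}"] lp_partial_sum_le[OF y, of "{..<N}"]
        by (intro mult_left_mono add_mono) (auto simp: a_def b_def divide_le_eq)
      finally show ?thesis using uv by simp
    qed
    from lp_normI[of "a + b" "\<lambda>n. x n + y n", OF _ this] ab show ?thesis by auto
  qed
  show "(\<lambda>n. x n + y n) \<in> lp p" using key by simp
  show "lp_norm p (\<lambda>n. x n + y n) \<le> lp_norm p x + lp_norm p y" using key a_def b_def by simp
qed

lemma lp_diff:
  assumes x: "x \<in> lp p" and y: "y \<in> lp p"
  shows "(\<lambda>n. x n - y n) \<in> lp p" and "lp_norm p (\<lambda>n. x n - y n) \<le> lp_norm p x + lp_norm p y"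
  using lp_add[OF x lp_scale(1)[OF y, of "-1"]] lp_scale(2)[OF y, of "-1"] by simp_all

lemma lp_norm_diff_ge:
  assumes x: "x \<in> lp p" and y: "y \<in> lp p"
  shows "lp_norm p x - lp_norm p y \<le> lp_norm p (\<lambda>n. x n - y n)"
  using lp_add(2)[OF lp_diff(1)[OF x y] y] by simp

lemma lp_sum:
  assumes "finite I" "\<And>i. i \<in> I \<Longrightarrow> f i \<in> lp p"
  shows "(\<lambda>n. \<Sum>i\<in>I. f i n) \<in> lp p \<and> lp_norm p (\<lambda>n. \<Sum>i\<in>I. f i n) \<le> (\<Sum>i\<in>I. lp_norm p (f i))"
  using assms
proof (induction I rule: finite_induct)
  case empty
  then show ?case using lp_zero by simp
next
  case (insert i I)
  then have "f i \<in> lp p" and IH: "(\<lambda>n. \<Sum>i\<in>I. f i n) \<in> lp p"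
    "lp_norm p (\<lambda>n. \<Sum>i\<in>I. f i n) \<le> (\<Sum>i\<in>I. lp_norm p (f i))" by auto
  from lp_add[OF this(1,2)] IH(2) insert.hyps show ?case by simp
qed

lemma basis_vec_lp: "basis_vec n \<in> lp p" and lp_norm_basis_vec: "lp_norm p (basis_vec n) = 1"
proof -
  have e: "norm (basis_vec n k) powr p = (if k = n then 1 else 0)" for k
    by (simp add: basis_vec_def)
  show "basis_vec n \<in> lp p" unfolding lp_def mem_Collect_eq e by simp
  show "lp_norm p (basis_vec n) = 1" unfolding lp_norm_def e 
    using suminf_finite[of "{n}" "\<lambda>k. if k = n then 1 else 0 :: real"] by simp
qed

lemma basis_vec_nonzero: "basis_vec n \<noteq> (\<lambda>_. 0)"
  by (metis basis_vec_def zero_neq_one)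

lemma lp_tail_norm_tendsto_0:
  assumes x: "x \<in> lp p"
  shows "(\<lambda>N. lp_norm p (\<lambda>k. if N \<le> k then x k else 0)) \<longlonglongrightarrow> 0"
proof -
  have s: "summable (\<lambda>n. norm (x n) powr p)" using x by (simp add: lp_def)
  have e: "lp_norm p (\<lambda>k. if N \<le> k then x k else 0)
      = ((\<Sum>n. norm (x n) powr p) - (\<Sum>n<N. norm (x n) powr p)) powr (1/p)" for N
  proof -
    have "(\<lambda>k. norm (if N \<le> k then x k else 0) powr p)
        sums ((\<Sum>n. norm (x n) powr p) - (\<Sum>n<N. norm (x n) powr p))"
    proof -
      have "(\<lambda>k. norm (x k) powr p - (if k < N then norm (x k) powr p else 0))
        sums ((\<Sum>n. norm (x n) powr p) - (\<Sum>n<N. norm (x n) powr p))"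
        using sums_diff[OF summable_sums[OF s] sums_If_finite_set[of "{..<N}" "\<lambda>k. norm (x k) powr p"]]
        by simp
      moreover have "(\<lambda>k. norm (x k) powr p - (if k < N then norm (x k) powr p else 0))
          = (\<lambda>k. norm (if N \<le> k then x k else 0) powr p)" by auto
      ultimately show ?thesis by simp
    qed
    then show ?thesis by (simp add: lp_norm_def sums_iff)
  qed
  have "(\<lambda>N. (\<Sum>n. norm (x n) powr p) - (\<Sum>n<N. norm (x n) powr p)) \<longlonglongrightarrow> 0"
    using tendsto_diff[OF tendsto_const[of "\<Sum>n. norm (x n) powr p"] summable_LIMSEQ[OF s]] by simp
  moreover have "\<forall>\<^sub>F N in sequentially. 0 \<le> (\<Sum>n. norm (x n) powr p) - (\<Sum>n<N. norm (x n) powr p)"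
    by (intro always_eventually allI) (simp add: sum_le_suminf[OF s])
  ultimately show ?thesis
    using tendsto_powr'[OF _ tendsto_const[of "1/p"]] p1 unfolding e by fastforce
qed

text \<open>Fatou's lemma for the counting measure.  It stands in for completeness: limits are taken
  coordinatewise, and this lemma puts them into \<open>\<ell>\<^sup>p\<close> with the expected norm bound.\<close>

lemma lp_norm_pointwise_limit:
  assumes lim: "\<And>k. (\<lambda>m. v m k) \<longlonglongrightarrow> x k"
    and v: "\<And>m. m \<ge> m0 \<Longrightarrow> v m \<in> lp p" "\<And>m. m \<ge> m0 \<Longrightarrow> lp_norm p (v m) \<le> K"
  shows "x \<in> lp p" and "lp_norm p x \<le> K"
proof -
  have K: "0 \<le> K" using v(2)[of m0] lp_norm_nonneg[of "v m0"] by linarith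
  have *: "(\<Sum>n<N. norm (x n) powr p) \<le> K powr p" for N
  proof (rule tendsto_upperbound)
    show "(\<lambda>m. \<Sum>n<N. norm (v m n) powr p) \<longlonglongrightarrow> (\<Sum>n<N. norm (x n) powr p)"
      using p1 by (intro tendsto_sum tendsto_powr' tendsto_norm lim tendsto_const) auto
    have "(\<Sum>n<N. norm (v m n) powr p) \<le> K powr p" if "m \<ge> m0" for m
    proof -
      have "(\<Sum>n<N. norm (v m n) powr p) \<le> lp_norm p (v m) powr p"
        using lp_partial_sum_le[OF v(1)[OF that]] by simp
      also have "\<dots> \<le> K powr p" using p1 v(2)[OF that] lp_norm_nonneg
        by (intro powr_mono2) auto
      finally show ?thesis .
    qed
    then show "\<forall>\<^sub>F m in sequentially. (\<Sum>n<N. norm (v m n) powr p) \<le> K powr p"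
      by (auto simp: eventually_sequentially)
  qed simp
  show "x \<in> lp p" "lp_norm p x \<le> K" using lp_normI[OF K *] by auto
qed

section \<open>Bounded operators\<close>

lemma bounded_ops_lp: "A \<in> bounded_ops p \<Longrightarrow> x \<in> lp p \<Longrightarrow> A x \<in> lp p"
  by (auto simp: bounded_ops_def)

lemma bounded_ops_add:
  "A \<in> bounded_ops p \<Longrightarrow> x \<in> lp p \<Longrightarrow> y \<in> lp p \<Longrightarrow> A (\<lambda>n. x n + y n) = (\<lambda>n. A x n + A y n)"
  by (simp add: bounded_ops_def)

lemma bounded_ops_scale:
  "A \<in> bounded_ops p \<Longrightarrow> x \<in> lp p \<Longrightarrow> A (\<lambda>n. c * x n) = (\<lambda>n. c * A x n)"
  by (simp add: bounded_ops_def)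

lemma bounded_ops_extensional: "A \<in> bounded_ops p \<Longrightarrow> A \<in> extensional (lp p)"
  by (auto simp: bounded_ops_def PiE_def)

lemma bounded_opsI:
  assumes "A \<in> extensional (lp p)" "\<And>x. x \<in> lp p \<Longrightarrow> A x \<in> lp p"
    and "\<And>x y. x \<in> lp p \<Longrightarrow> y \<in> lp p \<Longrightarrow> A (\<lambda>n. x n + y n) = (\<lambda>n. A x n + A y n)"
    and "\<And>c x. x \<in> lp p \<Longrightarrow> A (\<lambda>n. c * x n) = (\<lambda>n. c * A x n)"
    and "\<And>x. x \<in> lp p \<Longrightarrow> lp_norm p (A x) \<le> C * lp_norm p x"
  shows "A \<in> bounded_ops p"
proof -
  have "A \<in> lp p \<rightarrow>\<^sub>E lp p" using assms(1,2) by (simp add: PiE_def)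
  moreover have "\<exists>C. \<forall>x\<in>lp p. lp_norm p (A x) \<le> C * lp_norm p x" using assms(5) by blast
  ultimately show ?thesis unfolding bounded_ops_def using assms(3,4) by simp
qed

lemma bounded_ops_eqI:
  assumes "A \<in> bounded_ops p" "B \<in> bounded_ops p" "\<And>x. x \<in> lp p \<Longrightarrow> A x = B x"
  shows "A = B"
  using assms(3) bounded_ops_extensional[OF assms(1)] bounded_ops_extensional[OF assms(2)]
  by (rule extensionalityI[rotated 2])

lemma lp_norm_le_op_norm:
  assumes A: "A \<in> bounded_ops p" and x: "x \<in> lp p"
  shows "lp_norm p (A x) \<le> op_norm p A * lp_norm p x"
proof (cases "x = (\<lambda>_. 0)")
  case True
  have "A (\<lambda>_. 0) = (\<lambda>_. 0)" using bounded_ops_scale[OF A x, of 0] True by simp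
  then show ?thesis using True lp_zero by simp
next
  case False
  obtain C where C: "\<And>x. x \<in> lp p \<Longrightarrow> lp_norm p (A x) \<le> C * lp_norm p x"
    using A unfolding bounded_ops_def by blast
  have bdd: "bdd_above ((\<lambda>x. lp_norm p (A x)) ` {x \<in> lp p. lp_norm p x \<le> 1})"
  proof (intro bdd_aboveI2)
    fix y assume y: "y \<in> {x \<in> lp p. lp_norm p x \<le> 1}"
    then have "C * lp_norm p y \<le> \<bar>C\<bar> * 1"
      using lp_norm_nonneg[of y] by (intro mult_mono) auto
    then show "lp_norm p (A y) \<le> \<bar>C\<bar>" using C[of y] y by simp
  qed
  have pos: "0 < lp_norm p x" by (rule lp_norm_pos[OF x False])
  define y where "y = (\<lambda>n. complex_of_real (1 / lp_norm p x) * x n)"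
  have y: "y \<in> lp p" "lp_norm p y \<le> 1"
    using lp_scale[OF x, of "complex_of_real (1 / lp_norm p x)"] pos
    by (auto simp: y_def norm_divide)
  have "lp_norm p (A y) = lp_norm p (A x) / lp_norm p x"
    using lp_scale(2)[OF bounded_ops_lp[OF A x], of "complex_of_real (1 / lp_norm p x)"] pos
    unfolding y_def bounded_ops_scale[OF A x] by (simp add: norm_divide)
  moreover have "lp_norm p (A y) \<le> op_norm p A"
    unfolding op_norm_def using y by (intro cSUP_upper bdd) auto
  ultimately show ?thesis using pos by (simp add: divide_le_eq)
qed

lemma op_norm_le:
  assumes "0 \<le> K" "\<And>x. x \<in> lp p \<Longrightarrow> lp_norm p (A x) \<le> K * lp_norm p x"
  shows "op_norm p A \<le> K"
  unfolding op_norm_def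
proof (rule cSUP_least)
  show "{x \<in> lp p. lp_norm p x \<le> 1} \<noteq> {}" using lp_zero by force
  fix x assume "x \<in> {x \<in> lp p. lp_norm p x \<le> 1}"
  then have "x \<in> lp p" "K * lp_norm p x \<le> K * 1" using assms(1) by (auto intro: mult_left_le)
  then show "lp_norm p (A x) \<le> K" using assms(2)[of x] by simp
qed

lemma op_norm_nonneg:
  assumes "A \<in> bounded_ops p" shows "0 \<le> op_norm p A"
proof -
  have "0 \<le> lp_norm p (A (basis_vec 0))" by (rule lp_norm_nonneg)
  also have "\<dots> \<le> op_norm p A"
    using lp_norm_le_op_norm[OF assms basis_vec_lp] lp_norm_basis_vec by simp
  finally show ?thesis .
qed

lemma bounded_ops_diff:
  assumes "A \<in> bounded_ops p" "x \<in> lp p" "y \<in> lp p"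
  shows "A (\<lambda>n. x n - y n) = (\<lambda>n. A x n - A y n)"
  using bounded_ops_add[OF assms(1,2) lp_scale(1)[OF assms(3), of "-1"]]
    bounded_ops_scale[OF assms(1,3), of "-1"] by simp

lemma bounded_ops_sum:
  assumes A: "A \<in> bounded_ops p" and "finite I" "\<And>i. i \<in> I \<Longrightarrow> f i \<in> lp p"
  shows "A (\<lambda>n. \<Sum>i\<in>I. f i n) = (\<lambda>n. \<Sum>i\<in>I. A (f i) n)"
  using assms(2,3)
proof (induction I rule: finite_induct)
  case empty
  then show ?case using bounded_ops_scale[OF A lp_zero(1), of 0] by simp
next
  case (insert i I)
  then have "f i \<in> lp p" "(\<lambda>n. \<Sum>i\<in>I. f i n) \<in> lp p"
    using lp_sum[of I f] by auto
  from bounded_ops_add[OF A this] insert show ?case by simp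
qed

lemma op_id_bounded: "op_id p \<in> bounded_ops p"
  by (rule bounded_opsI[where C=1]) (auto simp: op_id_def lp_add lp_scale)

lemma op_add_bounded:
  assumes A: "A \<in> bounded_ops p" and B: "B \<in> bounded_ops p"
  shows "op_add p A B \<in> bounded_ops p"
proof (rule bounded_opsI[where C="op_norm p A + op_norm p B"])
  fix x assume x: "x \<in> lp p"
  have "lp_norm p (op_add p A B x) \<le> lp_norm p (A x) + lp_norm p (B x)"
    using lp_add(2)[OF bounded_ops_lp[OF A x] bounded_ops_lp[OF B x]] x by (simp add: op_add_def)
  also have "\<dots> \<le> (op_norm p A + op_norm p B) * lp_norm p x"
    using lp_norm_le_op_norm[OF A x] lp_norm_le_op_norm[OF B x] by (simp add: algebra_simps)
  finally show "lp_norm p (op_add p A B x) \<le> (op_norm p A + op_norm p B) * lp_norm p x" .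
qed (use A B in \<open>auto simp: op_add_def lp_add lp_scale bounded_ops_lp bounded_ops_add
      bounded_ops_scale algebra_simps\<close>)

lemma op_scale_bounded:
  assumes A: "A \<in> bounded_ops p"
  shows "op_scale p c A \<in> bounded_ops p"
proof (rule bounded_opsI[where C="norm c * op_norm p A"])
  fix x assume x: "x \<in> lp p"
  show "lp_norm p (op_scale p c A x) \<le> norm c * op_norm p A * lp_norm p x"
    using lp_scale(2)[OF bounded_ops_lp[OF A x]] lp_norm_le_op_norm[OF A x] x
    by (simp add: op_scale_def mult.assoc mult_left_mono)
qed (use A in \<open>auto simp: op_scale_def lp_add lp_scale bounded_ops_lp bounded_ops_add
      bounded_ops_scale algebra_simps\<close>)

lemma compose_bounded:
  assumes A: "A \<in> bounded_ops p" and B: "B \<in> bounded_ops p"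
  shows "compose (lp p) A B \<in> bounded_ops p"
proof (rule bounded_opsI[where C="op_norm p A * op_norm p B"])
  fix x assume x: "x \<in> lp p"
  have "lp_norm p (A (B x)) \<le> op_norm p A * lp_norm p (B x)"
    by (rule lp_norm_le_op_norm[OF A bounded_ops_lp[OF B x]])
  also have "\<dots> \<le> op_norm p A * (op_norm p B * lp_norm p x)"
    by (intro mult_left_mono lp_norm_le_op_norm[OF B x] op_norm_nonneg[OF A])
  finally show "lp_norm p (compose (lp p) A B x) \<le> op_norm p A * op_norm p B * lp_norm p x"
    using x by (simp add: compose_def mult.assoc)
qed (use A B in \<open>auto simp: compose_def lp_add lp_scale bounded_ops_lp bounded_ops_add
      bounded_ops_scale\<close>)

lemma truncation_lp:
  assumes "x \<in> lp p" shows "(\<lambda>k. if k < N then x k else 0) \<in> lp p"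
  by (rule lp_mono(1)[OF assms]) simp

lemma bounded_ops_truncation_error:
  assumes A: "A \<in> bounded_ops p" and x: "x \<in> lp p"
  shows "(\<lambda>N. lp_norm p (\<lambda>n. A x n - A (\<lambda>k. if k < N then x k else 0) n)) \<longlonglongrightarrow> 0"
proof (rule tendsto_sandwich[where f="\<lambda>_. 0" and
      h="\<lambda>N. op_norm p A * lp_norm p (\<lambda>k. if N \<le> k then x k else 0)"])
  have e: "(\<lambda>n. A x n - A (\<lambda>k. if k < N then x k else 0) n) = A (\<lambda>k. if N \<le> k then x k else 0)" for N
    unfolding bounded_ops_diff[OF A x truncation_lp[OF x], symmetric]
    by (rule arg_cong[of _ _ A]) auto
  have "(\<lambda>k. if N \<le> k then x k else 0) \<in> lp p" for N
    by (rule lp_mono(1)[OF x]) simp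
  then show "\<forall>\<^sub>F N in sequentially. lp_norm p (\<lambda>n. A x n - A (\<lambda>k. if k < N then x k else 0) n)
      \<le> op_norm p A * lp_norm p (\<lambda>k. if N \<le> k then x k else 0)"
    unfolding e by (intro always_eventually allI lp_norm_le_op_norm[OF A])
  show "(\<lambda>N. op_norm p A * lp_norm p (\<lambda>k. if N \<le> k then x k else 0)) \<longlonglongrightarrow> 0"
    using tendsto_mult[OF tendsto_const lp_tail_norm_tendsto_0[OF x]] by simp
qed (auto simp: lp_norm_nonneg)

lemma bounded_ops_truncation_coord:
  assumes A: "A \<in> bounded_ops p" and x: "x \<in> lp p"
  shows "(\<lambda>N. A (\<lambda>k. if k < N then x k else 0) n) \<longlonglongrightarrow> A x n"
proof -
  have "norm (A x n - A (\<lambda>k. if k < N then x k else 0) n)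
      \<le> lp_norm p (\<lambda>n. A x n - A (\<lambda>k. if k < N then x k else 0) n)" for N
    using lp_coord_le[OF lp_diff(1)[OF bounded_ops_lp[OF A x] bounded_ops_lp[OF A truncation_lp[OF x]]]] .
  then have "(\<lambda>N. A x n - A (\<lambda>k. if k < N then x k else 0) n) \<longlonglongrightarrow> 0"
    by (intro Lim_null_comparison[OF _ bounded_ops_truncation_error[OF A x]] always_eventually allI)
  from tendsto_diff[OF tendsto_const[of "A x n"] this] show ?thesis by simp
qed

lemma bounded_ops_truncation_norm_le:
  assumes A: "A \<in> bounded_ops p" and x: "x \<in> lp p"
    and le: "\<And>N. lp_norm p (A (\<lambda>k. if k < N then x k else 0)) \<le> K"
  shows "lp_norm p (A x) \<le> K"
  by (rule lp_norm_pointwise_limit(2)[OF bounded_ops_truncation_coord[OF A x]])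
    (use le bounded_ops_lp[OF A truncation_lp[OF x]] in auto)

lemma truncation_eq_sum_basis:
  "(\<lambda>k. if k < N then x k else 0) = (\<lambda>k. \<Sum>i<N. x i * basis_vec i k)"
  by (auto simp: basis_vec_def if_distrib cong: if_cong)

lemma bounded_ops_truncation:
  assumes A: "A \<in> bounded_ops p"
  shows "A (\<lambda>k. if k < N then x k else 0) = (\<lambda>k. \<Sum>i<N. x i * A (basis_vec i) k)"
  unfolding truncation_eq_sum_basis
  using bounded_ops_sum[OF A, of "{..<N}" "\<lambda>i k. x i * basis_vec i k"]
  by (simp add: lp_scale basis_vec_lp bounded_ops_scale[OF A])

text \<open>The definition prescribes \<open>T\<close> on basis vectors only; continuity and density of the finitely supported
  sequences determine every coordinate of \<open>T x\<close>.\<close>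

lemma weighted_shift_apply:
  assumes T: "forward_weighted_shift p w T" and x: "x \<in> lp p"
  shows "T x 0 = 0" and "T x (Suc n) = w n * x n"
proof -
  have Tb: "T \<in> bounded_ops p" and Te: "\<And>n. T (basis_vec n) = (\<lambda>k. w n * basis_vec (Suc n) k)"
    using T by (auto simp: forward_weighted_shift_def)
  have "T (\<lambda>k. if k < N then x k else 0) 0 = 0" for N
    unfolding bounded_ops_truncation[OF Tb] Te by (simp add: basis_vec_def)
  then show "T x 0 = 0"
    using bounded_ops_truncation_coord[OF Tb x, of 0] by (simp add: LIMSEQ_const_iff)
  have "T (\<lambda>k. if k < N then x k else 0) (Suc n) = w n * x n" if "N > n" for N
    unfolding bounded_ops_truncation[OF Tb] Te using that
    by (simp add: basis_vec_def if_distrib mult.commute cong: if_cong)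
  then have "(\<lambda>N. T (\<lambda>k. if k < N then x k else 0) (Suc n)) \<longlonglongrightarrow> w n * x n"
    by (intro tendsto_eventually) (auto simp: eventually_sequentially intro!: exI[of _ "Suc n"])
  then show "T x (Suc n) = w n * x n"
    using bounded_ops_truncation_coord[OF Tb x, of "Suc n"] LIMSEQ_unique by blast
qed

section \<open>Averaging over rotations\<close>

lemma rotation_lp:
  assumes "x \<in> lp p" "norm u = 1"
  shows "(\<lambda>k. u ^ k * x k) \<in> lp p" and "lp_norm p (\<lambda>k. u ^ k * x k) = lp_norm p x"
  using lp_norm_cong_norm[of "\<lambda>k. u ^ k * x k" x] assms by (auto simp: norm_mult norm_power)

lemma roots_of_unity_orthogonality:
  fixes N :: nat
  assumes "i < N" "k < N"
  defines "\<omega> \<equiv> cis (2 * pi / N)"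
  shows "(\<Sum>j<N. cnj (\<omega> ^ j) ^ i * (\<omega> ^ j) ^ k) = (if k = i then of_nat N else 0)"
proof -
  define q where "q = cnj \<omega> ^ i * \<omega> ^ k"
  have "cnj (\<omega> ^ j) ^ i * (\<omega> ^ j) ^ k = q ^ j" for j
    by (simp add: q_def power_mult_distrib power_mult[symmetric] mult.commute)
  then have s: "(\<Sum>j<N. cnj (\<omega> ^ j) ^ i * (\<omega> ^ j) ^ k) = (\<Sum>j<N. q ^ j)" by simp
  have unit: "cnj \<omega> * \<omega> = 1" by (simp add: \<omega>_def cis_cnj cis_mult)
  have \<omega>N: "\<omega> ^ N = 1"
    using assms(1) unfolding \<omega>_def Complex.DeMoivre by simp
  have qN: "q ^ N = 1"
    using \<omega>N by (simp add: q_def power_mult_distrib power_mult[symmetric])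
      (metis \<omega>N complex_cnj_one complex_cnj_power mult.commute mult_1 power_mult power_one)
  show ?thesis
  proof (cases "k = i")
    case True
    then have "q = 1" using unit by (simp add: q_def power_mult_distrib[symmetric])
    then show ?thesis using s True by simp
  next
    case False
    have "q \<noteq> 1"
    proof
      assume "q = 1"
      then have "\<omega> ^ i * q = \<omega> ^ i" by simp
      moreover have "\<omega> ^ i * q = (cnj \<omega> * \<omega>) ^ i * \<omega> ^ k"
        by (simp add: q_def power_mult_distrib mult_ac)
      ultimately have "\<omega> ^ k = \<omega> ^ i" using unit by simp
      then have "cis (2 * pi * real k / real N) = cis (2 * pi * real i / real N)"
        unfolding \<omega>_def Complex.DeMoivre by (simp add: mult_ac)
      moreover have "inj_on (\<lambda>k. cis (2 * pi * real k / real N)) {..<N}"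
        using Complex.bij_betw_roots_unity[of N] assms(1) by (auto simp: bij_betw_def)
      ultimately show False using assms(1,2) False by (auto dest: inj_onD)
    qed
    then have "(\<Sum>j<N. q ^ j) = 0" using qN by (simp add: geometric_sum)
    then show ?thesis using s False by simp
  qed
qed

text \<open>The vectors \<open>x\<^sub>i\<close> are the columns of a matrix, and the sum in the hypothesis applies to the vector of ones
  on \<open>I\<close> the matrix conjugated by the rotation \<open>U\<^sub>u\<close>.  The conjugates average to the diagonal of the
  matrix, and averages do not increase the bound \<open>K\<close>.  The average is taken over the \<open>N\<close>-th roots of unity:
  for \<open>N > max I\<close> it is exact on the coordinates below \<open>N\<close>, and what is left over is bounded by the tails of
  the columns beyond \<open>N\<close>, which vanish as \<open>N \<rightarrow> \<infinity>\<close>.\<close>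

lemma norm_diagonal_le:
  assumes B: "B \<in> bounded_ops p" and I: "finite I" and x: "\<And>i. i \<in> I \<Longrightarrow> x i \<in> lp p"
    and K: "\<And>u. norm u = 1 \<Longrightarrow> lp_norm p (B (\<lambda>k. \<Sum>i\<in>I. cnj u ^ i * u ^ k * x i k)) \<le> K"
  shows "lp_norm p (B (\<lambda>k. if k \<in> I then x k k else 0)) \<le> K"
proof -
  define v where "v = (\<lambda>k. if k \<in> I then x k k else 0)"
  define g where "g u = (\<lambda>k. \<Sum>i\<in>I. cnj u ^ i * u ^ k * x i k)" for u
  define tail where "tail N i = (\<lambda>k. if N \<le> k then x i k else 0)" for N i
  obtain N0 where N0: "\<And>i. i \<in> I \<Longrightarrow> i < N0"
    using I by (metis finite_nat_iff_bounded lessThan_iff subsetD)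
  have g_lp: "g u \<in> lp p" if u: "norm u = 1" for u
    unfolding g_def using rotation_lp(1)[OF x u] lp_sum[OF I, of "\<lambda>i k. cnj u ^ i * u ^ k * x i k"]
    by (simp add: mult.assoc lp_scale(1))
  have tail_lp: "tail N i \<in> lp p" if "i \<in> I" for N i
    unfolding tail_def by (rule lp_mono(1)[OF x[OF that]]) simp
  have bound: "v \<in> lp p \<and> lp_norm p (B v) \<le> K + op_norm p B * (\<Sum>i\<in>I. lp_norm p (tail N i))"
    if N: "N > N0" for N
  proof -
    define \<omega> where "\<omega> = cis (2 * pi / N)"
    have unit: "norm (\<omega> ^ j) = 1" for j by (simp add: \<omega>_def norm_power)
    define avg where "avg = (\<lambda>k. \<Sum>j<N. of_real (1 / real N) * g (\<omega> ^ j) k)"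
    have gj: "g (\<omega> ^ j) \<in> lp p" for j by (rule g_lp[OF unit])
    have avg_lp: "avg \<in> lp p"
      unfolding avg_def
      by (rule lp_sum[THEN conjunct1]) (intro finite_lessThan lp_scale(1)[OF gj])+
    have B_avg: "B avg = (\<lambda>k. \<Sum>j<N. of_real (1 / real N) * B (g (\<omega> ^ j)) k)"
      unfolding avg_def
      using bounded_ops_sum[OF B, of "{..<N}" "\<lambda>j k. of_real (1 / real N) * g (\<omega> ^ j) k"]
      by (simp only: bounded_ops_scale[OF B gj] lp_scale(1)[OF gj] finite_lessThan)
    have "lp_norm p (B avg) \<le> (\<Sum>j<N. lp_norm p (\<lambda>k. of_real (1 / real N) * B (g (\<omega> ^ j)) k))"
      unfolding B_avg
      by (rule lp_sum[THEN conjunct2]) (intro finite_lessThan lp_scale(1)[OF bounded_ops_lp[OF B gj]])+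
    also have "\<dots> = (\<Sum>j<N. 1 / real N * lp_norm p (B (g (\<omega> ^ j))))"
      by (simp only: lp_scale(2)[OF bounded_ops_lp[OF B gj]]) (simp add: norm_divide)
    also have "\<dots> \<le> (\<Sum>j<N. 1 / real N * K)"
      using K[OF unit] by (intro sum_mono mult_left_mono) (auto simp: g_def)
    also have "\<dots> = K" using N by simp
    finally have Bavg: "lp_norm p (B avg) \<le> K" .
    have avg_small: "avg k = v k" if "k < N" for k
    proof -
      have "avg k = of_real (1 / real N) * (\<Sum>j<N. \<Sum>i\<in>I. cnj (\<omega> ^ j) ^ i * (\<omega> ^ j) ^ k * x i k)"
        by (simp add: avg_def g_def sum_distrib_left)
      also have "(\<Sum>j<N. \<Sum>i\<in>I. cnj (\<omega> ^ j) ^ i * (\<omega> ^ j) ^ k * x i k)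
          = (\<Sum>i\<in>I. (\<Sum>j<N. cnj (\<omega> ^ j) ^ i * (\<omega> ^ j) ^ k) * x i k)"
        by (subst sum.swap) (simp add: sum_distrib_right)
      also have "\<dots> = (\<Sum>i\<in>I. (if k = i then of_nat N else 0) * x i k)"
        using N0 N that unfolding \<omega>_def
        by (intro sum.cong refl arg_cong2[of _ _ _ _ "(*)"] roots_of_unity_orthogonality) force+
      also have "of_real (1 / real N) * \<dots> = v k"
        using N I by (simp add: v_def if_distrib[of "\<lambda>a. a * _"] cong: if_cong)
      finally show ?thesis .
    qed
    have avg_large: "norm (avg k) \<le> (\<Sum>i\<in>I. norm (x i k))" for k
    proof -
      have "norm (avg k) \<le> (\<Sum>j<N. 1 / real N * norm (g (\<omega> ^ j) k))"
        unfolding avg_def by (rule order_trans[OF norm_sum]) (simp add: norm_mult norm_divide)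
      also have "\<dots> \<le> (\<Sum>j<N. 1 / real N * (\<Sum>i\<in>I. norm (x i k)))"
      proof (intro sum_mono mult_left_mono)
        fix j
        show "norm (g (\<omega> ^ j) k) \<le> (\<Sum>i\<in>I. norm (x i k))"
          unfolding g_def by (rule order_trans[OF norm_sum]) (simp add: norm_mult norm_power \<omega>_def)
      qed simp
      also have "\<dots> = (\<Sum>i\<in>I. norm (x i k))" using N by simp
      finally show ?thesis .
    qed
    define h where "h = (\<lambda>k. \<Sum>i\<in>I. complex_of_real (norm (tail N i k)))"
    have tn: "(\<lambda>k. complex_of_real (norm (tail N i k))) \<in> lp p"
      "lp_norm p (\<lambda>k. complex_of_real (norm (tail N i k))) = lp_norm p (tail N i)" if "i \<in> I" for i
      using lp_norm_cong_norm[of "\<lambda>k. complex_of_real (norm (tail N i k))" "tail N i"] tail_lp[OF that]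
      by auto
    have h: "h \<in> lp p" "lp_norm p h \<le> (\<Sum>i\<in>I. lp_norm p (tail N i))"
      using lp_sum[OF I, of "\<lambda>i k. complex_of_real (norm (tail N i k))"] tn by (auto simp: h_def)
    have diff_le: "norm (v k - avg k) \<le> norm (h k)" for k
    proof (cases "k < N")
      case True
      then show ?thesis using avg_small by simp
    next
      case False
      then have "k \<notin> I" using N0 N by force
      moreover have "norm (h k) = (\<Sum>i\<in>I. norm (x i k))"
        using False unfolding h_def tail_def of_real_sum[symmetric] norm_of_real
        by (simp add: sum_nonneg)
      ultimately show ?thesis using avg_large[of k] by (simp add: v_def)
    qed
    have d: "(\<lambda>k. v k - avg k) \<in> lp p" "lp_norm p (\<lambda>k. v k - avg k) \<le> (\<Sum>i\<in>I. lp_norm p (tail N i))"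
      using lp_mono[OF h(1) diff_le] h(2) by auto
    have v: "v \<in> lp p" using lp_add(1)[OF d(1) avg_lp] by simp
    have "B v = (\<lambda>k. B (\<lambda>k. v k - avg k) k + B avg k)"
      using bounded_ops_add[OF B d(1) avg_lp] by simp
    then have "lp_norm p (B v) \<le> lp_norm p (B (\<lambda>k. v k - avg k)) + lp_norm p (B avg)"
      using lp_add(2)[OF bounded_ops_lp[OF B d(1)] bounded_ops_lp[OF B avg_lp]] by simp
    also have "lp_norm p (B (\<lambda>k. v k - avg k)) \<le> op_norm p B * (\<Sum>i\<in>I. lp_norm p (tail N i))"
      using lp_norm_le_op_norm[OF B d(1)] d(2) op_norm_nonneg[OF B]
      by (meson mult_left_mono order_trans)
    finally show ?thesis using Bavg v by simp
  qed
  have "(\<lambda>N. K + op_norm p B * (\<Sum>i\<in>I. lp_norm p (tail N i))) \<longlonglongrightarrow> K + op_norm p B * (\<Sum>i\<in>I. 0)"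
    unfolding tail_def by (intro tendsto_intros lp_tail_norm_tendsto_0[OF x])
  then have "lp_norm p (B v) \<le> K + op_norm p B * (\<Sum>i\<in>I. 0)"
    by (rule LIMSEQ_le_const) (use bound in \<open>auto intro!: exI[of _ "Suc N0"]\<close>)
  then show ?thesis by (simp add: v_def)
qed

section \<open>The weakly closed algebra generated by an operator\<close>

lemma coord_bounded_functional:
  assumes "A \<in> bounded_ops p"
  shows "(\<lambda>y\<in>lp p. c * A y k) \<in> bounded_functionals p"
proof -
  have "norm (c * A y k) \<le> norm c * op_norm p A * lp_norm p y" if "y \<in> lp p" for y
    using order_trans[OF lp_coord_le[OF bounded_ops_lp[OF assms that], of k]
        lp_norm_le_op_norm[OF assms that]]
    by (simp add: norm_mult mult.assoc mult_left_mono)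
  then have "\<exists>C. \<forall>y\<in>lp p. norm (c * A y k) \<le> C * lp_norm p y" by blast
  then show ?thesis
    using assms by (simp add: bounded_functionals_def lp_add lp_scale
        bounded_ops_add bounded_ops_scale algebra_simps)
qed

lemma coord_bounded_functional_1:
  assumes "A \<in> bounded_ops p"
  shows "(\<lambda>y\<in>lp p. A y k) \<in> bounded_functionals p"
  using coord_bounded_functional[OF assms, of 1] by simp

lemma coord_bounded_functional_id: "(\<lambda>y\<in>lp p. c * y k) \<in> bounded_functionals p"
proof -
  have "(\<lambda>y\<in>lp p. c * op_id p y k) = (\<lambda>y\<in>lp p. c * y k)"
    by (rule restrict_ext) (simp add: op_id_def)
  then show ?thesis using coord_bounded_functional[OF op_id_bounded, of c k] by simp
qed

lemma topspace_weak_operator_topology: "topspace (weak_operator_topology p) = bounded_ops p"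
proof -
  have "bounded_ops p \<in> {{A \<in> bounded_ops p. \<phi> (A x) \<in> U} | \<phi> x U.
      \<phi> \<in> bounded_functionals p \<and> x \<in> lp p \<and> open U}"
    using coord_bounded_functional_id[of 1 0] basis_vec_lp
    by (intro CollectI exI[of _ "\<lambda>y\<in>lp p. 1 * y 0"] exI[of _ "basis_vec 0"] exI[of _ UNIV]) auto
  then show ?thesis unfolding weak_operator_topology_def topology_generated_by_topspace
    by (intro equalityI Union_upper) auto
qed

lemma continuous_map_weak_operator_topology:
  assumes "\<phi> \<in> bounded_functionals p" "x \<in> lp p"
  shows "continuous_map (weak_operator_topology p) euclidean (\<lambda>A. \<phi> (A x))"
  unfolding continuous_map_def topspace_weak_operator_topology
proof (intro conjI allI impI)
  fix U :: "complex set" assume "openin euclidean U"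
  then show "openin (weak_operator_topology p) {A \<in> bounded_ops p. \<phi> (A x) \<in> U}"
    unfolding weak_operator_topology_def
    using assms by (intro topology_generated_by_Basis) auto
qed simp

lemma closedin_weak_operator_topology_eq:
  assumes "\<And>i. i \<in> I \<Longrightarrow> \<phi> i \<in> bounded_functionals p \<and> x i \<in> lp p"
    and "\<And>i. i \<in> I \<Longrightarrow> \<psi> i \<in> bounded_functionals p \<and> y i \<in> lp p"
  shows "closedin (weak_operator_topology p) {A \<in> bounded_ops p. \<forall>i\<in>I. \<phi> i (A (x i)) = \<psi> i (A (y i))}"
proof -
  have "closedin (weak_operator_topology p) {A \<in> bounded_ops p. \<phi> i (A (x i)) = \<psi> i (A (y i))}"
    if "i \<in> I" for i
    using closedin_continuous_maps_eq[OF _ continuous_map_weak_operator_topology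
        continuous_map_weak_operator_topology, of "\<phi> i" "x i" "\<psi> i" "y i"] assms[OF that]
    by (simp add: topspace_weak_operator_topology)
  moreover have "closedin (weak_operator_topology p) (bounded_ops p)"
    using closedin_topspace[of "weak_operator_topology p"] by (simp add: topspace_weak_operator_topology)
  ultimately have "closedin (weak_operator_topology p)
      (\<Inter>(insert (bounded_ops p) ((\<lambda>i. {A \<in> bounded_ops p. \<phi> i (A (x i)) = \<psi> i (A (y i))}) ` I)))"
    by (intro closedin_Inter) auto
  also have "\<Inter>(insert (bounded_ops p) ((\<lambda>i. {A \<in> bounded_ops p. \<phi> i (A (x i)) = \<psi> i (A (y i))}) ` I))
      = {A \<in> bounded_ops p. \<forall>i\<in>I. \<phi> i (A (x i)) = \<psi> i (A (y i))}" by auto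
  finally show ?thesis .
qed

lemma wot_closed_algebra_subset:
  assumes "op_subalgebra p S" "op_id p \<in> S" "T \<in> S" "closedin (weak_operator_topology p) S"
  shows "wot_closed_algebra p T \<subseteq> S"
  using assms unfolding wot_closed_algebra_def by blast

lemma closedin_commuting:
  assumes C: "C \<in> bounded_ops p"
  shows "closedin (weak_operator_topology p) {A \<in> bounded_ops p. \<forall>x\<in>lp p. A (C x) = C (A x)}"
proof -
  have "closedin (weak_operator_topology p) {A \<in> bounded_ops p. \<forall>i\<in>lp p \<times> UNIV.
      (\<lambda>y\<in>lp p. 1 * y (snd i)) (A (C (fst i))) = (\<lambda>y\<in>lp p. C y (snd i)) (A (fst i))}"
    by (intro closedin_weak_operator_topology_eq conjI coord_bounded_functional_1[OF C]
        coord_bounded_functional_id bounded_ops_lp[OF C]) auto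
  also have "\<dots> = {A \<in> bounded_ops p. \<forall>x\<in>lp p. A (C x) = C (A x)}"
    using bounded_ops_lp C by (auto simp: fun_eq_iff)
  finally show ?thesis .
qed

text \<open>The set of operators commuting with everything that commutes with \<open>T\<close> is a weakly closed
  algebra containing \<open>T\<close>, so it contains \<open>\<A>(T)\<close>.\<close>

lemma wot_closed_algebra_bicommutant:
  assumes T: "T \<in> bounded_ops p" and A: "A \<in> wot_closed_algebra p T"
  shows "A \<in> bounded_ops p"
    and "\<lbrakk>C \<in> bounded_ops p; \<And>x. x \<in> lp p \<Longrightarrow> C (T x) = T (C x); x \<in> lp p\<rbrakk> \<Longrightarrow> A (C x) = C (A x)"
proof -
  define com where "com = {C \<in> bounded_ops p. \<forall>x\<in>lp p. C (T x) = T (C x)}"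
  define S where "S = {A \<in> bounded_ops p. \<forall>C\<in>com. \<forall>x\<in>lp p. A (C x) = C (A x)}"
  have com_T: "T \<in> com" using T by (simp add: com_def)
  have com_lp: "C x \<in> lp p" if "C \<in> com" "x \<in> lp p" for C x
    using that bounded_ops_lp by (auto simp: com_def)
  have com_b: "C \<in> bounded_ops p" if "C \<in> com" for C using that by (simp add: com_def)
  have "S = \<Inter>((\<lambda>C. {A \<in> bounded_ops p. \<forall>x\<in>lp p. A (C x) = C (A x)}) ` com)"
    using com_T by (auto simp: S_def)
  then have "closedin (weak_operator_topology p) S"
    using com_T closedin_commuting com_b by (auto intro!: closedin_Inter)
  moreover have "op_subalgebra p S"
    unfolding op_subalgebra_def
  proof (intro conjI ballI allI)
    show "S \<subseteq> bounded_ops p" by (auto simp: S_def)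
    have "op_id p \<in> S" using op_id_bounded com_lp by (auto simp: S_def op_id_def)
    then show "S \<noteq> {}" by auto
    fix A B assume AB: "A \<in> S" "B \<in> S"
    then have b: "A \<in> bounded_ops p" "B \<in> bounded_ops p" by (auto simp: S_def)
    show "op_add p A B \<in> S" using AB op_add_bounded[OF b] com_lp bounded_ops_lp b
      by (auto simp: S_def op_add_def bounded_ops_add com_b)
    show "compose (lp p) A B \<in> S" using AB compose_bounded[OF b] com_lp bounded_ops_lp b
      by (auto simp: S_def compose_def)
  next
    fix c A assume A: "A \<in> S"
    then have b: "A \<in> bounded_ops p" by (auto simp: S_def)
    show "op_scale p c A \<in> S" using A op_scale_bounded[OF b] com_lp bounded_ops_lp b
      by (auto simp: S_def op_scale_def bounded_ops_scale com_b)
  qed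
  moreover have "op_id p \<in> S" using op_id_bounded com_lp by (auto simp: S_def op_id_def)
  moreover have "T \<in> S" using T by (auto simp: S_def com_def)
  ultimately have "A \<in> S" using A wot_closed_algebra_subset by blast
  then show "A \<in> bounded_ops p"
    and "\<lbrakk>C \<in> bounded_ops p; \<And>x. x \<in> lp p \<Longrightarrow> C (T x) = T (C x); x \<in> lp p\<rbrakk> \<Longrightarrow> A (C x) = C (A x)"
    by (auto simp: S_def com_def)
qed

text \<open>On a coordinate where every \<open>T x\<close> vanishes, a polynomial in \<open>T\<close> acts through its constant term.
  That is an algebraic and weakly closed condition, so it passes to \<open>\<A>(T)\<close>; since \<open>0 \<in> Z\<close>, the constant
  term can be read off at \<open>e\<^sub>0\<close>.\<close>

lemma wot_closed_algebra_coord: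
  assumes T: "T \<in> bounded_ops p" and A: "A \<in> wot_closed_algebra p T"
    and Z: "\<And>x k. k \<in> Z \<Longrightarrow> x \<in> lp p \<Longrightarrow> T x k = 0" and z: "0 \<in> Z"
    and x: "x \<in> lp p" and k: "k \<in> Z"
  shows "A x k = A (basis_vec 0) 0 * x k"
proof -
  define S where "S = {A \<in> bounded_ops p. \<forall>x\<in>lp p. \<forall>k\<in>Z. A x k = A (basis_vec 0) 0 * x k}"
  note e0 = basis_vec_lp[of 0]
  have e00: "basis_vec 0 0 = 1" by (simp add: basis_vec_def)
  have "closedin (weak_operator_topology p) {A \<in> bounded_ops p. \<forall>i\<in>lp p \<times> Z.
      (\<lambda>y\<in>lp p. 1 * y (snd i)) (A (fst i)) = (\<lambda>y\<in>lp p. fst i (snd i) * y 0) (A (basis_vec 0))}"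
    by (intro closedin_weak_operator_topology_eq conjI coord_bounded_functional_id e0) auto
  also have "\<dots> = S"
    using bounded_ops_lp e0 by (auto simp: S_def mult.commute)
  finally have cl: "closedin (weak_operator_topology p) S" .
  have id: "op_id p \<in> S" using op_id_bounded e0 by (auto simp: S_def op_id_def e00)
  have "op_subalgebra p S"
    unfolding op_subalgebra_def
  proof (intro conjI ballI allI)
    show "S \<subseteq> bounded_ops p" by (auto simp: S_def)
    show "S \<noteq> {}" using id by auto
    fix A B assume AB: "A \<in> S" "B \<in> S"
    then have b: "A \<in> bounded_ops p" "B \<in> bounded_ops p" by (auto simp: S_def)
    show "op_add p A B \<in> S" using AB op_add_bounded[OF b] e0
      by (auto simp: S_def op_add_def algebra_simps)
    have AB0: "A (B y) k = A (basis_vec 0) 0 * (B (basis_vec 0) 0 * y k)" if "y \<in> lp p" "k \<in> Z" for y k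
      using AB that bounded_ops_lp[OF b(2)] by (simp add: S_def)
    show "compose (lp p) A B \<in> S" using compose_bounded[OF b] AB0 z e0
      by (auto simp: S_def compose_def e00)
  next
    fix c A assume A: "A \<in> S"
    then have b: "A \<in> bounded_ops p" by (auto simp: S_def)
    show "op_scale p c A \<in> S" using A op_scale_bounded[OF b] e0
      by (auto simp: S_def op_scale_def)
  qed
  moreover have "T \<in> S" using T Z z e0 by (auto simp: S_def)
  ultimately have "A \<in> S" using A id cl wot_closed_algebra_subset by blast
  then show ?thesis using x k by (simp add: S_def)
qed

section \<open>Uniform boundedness\<close>

text \<open>Take \<open>d\<close> of norm at most \<open>r\<close> with \<open>\<parallel>A d\<parallel> \<ge> r \<parallel>A\<parallel> / 2\<close>.  As
  \<open>2 \<parallel>A d\<parallel> \<le> \<parallel>A (x + d)\<parallel> + \<parallel>A (x - d)\<parallel>\<close>, one of \<open>x \<plusminus> d\<close> serves as \<open>y\<close>.\<close>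

lemma large_value_near:
  assumes A: "A \<in> bounded_ops p" and x: "x \<in> lp p" and r: "0 < r"
  shows "\<exists>y\<in>lp p. lp_norm p (\<lambda>n. y n - x n) \<le> r \<and> r * op_norm p A / 2 \<le> lp_norm p (A y)"
proof -
  have "\<exists>d\<in>lp p. lp_norm p d \<le> r \<and> r * op_norm p A / 2 \<le> lp_norm p (A d)"
  proof (rule ccontr)
    assume H: "\<not> ?thesis"
    have "op_norm p A \<noteq> 0"
      using H lp_zero r lp_norm_nonneg[of "A (\<lambda>_. 0)"] by force
    then have pos: "0 < op_norm p A" using op_norm_nonneg[OF A] by simp
    have "lp_norm p (A v) \<le> op_norm p A / 2 * lp_norm p v" if v: "v \<in> lp p" for v
    proof (cases "v = (\<lambda>_. 0)")
      case True
      then show ?thesis using lp_norm_le_op_norm[OF A v] lp_zero by simp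
    next
      case False
      then have vp: "0 < lp_norm p v" by (rule lp_norm_pos[OF v])
      define c where "c = complex_of_real (r / lp_norm p v)"
      have c: "norm c = r / lp_norm p v" using r vp by (simp add: c_def norm_divide)
      have "lp_norm p (A (\<lambda>n. c * v n)) < r * op_norm p A / 2"
        using H lp_scale[OF v, of c] vp c by (force simp: not_le)
      then have "r / lp_norm p v * lp_norm p (A v) < r * op_norm p A / 2"
        unfolding bounded_ops_scale[OF A v] lp_scale(2)[OF bounded_ops_lp[OF A v]] c .
      then show ?thesis using r vp by (simp add: field_simps)
    qed
    from op_norm_le[OF _ this] pos show False by simp
  qed
  then obtain d where d: "d \<in> lp p" "lp_norm p d \<le> r" "r * op_norm p A / 2 \<le> lp_norm p (A d)" by blast
  define y1 y2 where "y1 = (\<lambda>n. x n + d n)" and "y2 = (\<lambda>n. x n - d n)"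
  have y: "y1 \<in> lp p" "y2 \<in> lp p" using lp_add[OF x d(1)] lp_diff[OF x d(1)] by (auto simp: y1_def y2_def)
  have n: "lp_norm p (\<lambda>n. y1 n - x n) \<le> r" "lp_norm p (\<lambda>n. y2 n - x n) \<le> r"
    using d(2) lp_scale(2)[OF d(1), of "-1"] by (simp_all add: y1_def y2_def)
  have "A (\<lambda>n. 2 * d n) = (\<lambda>n. A y1 n - A y2 n)"
    using bounded_ops_diff[OF A y] by (simp add: y1_def y2_def)
  then have "2 * lp_norm p (A d) \<le> lp_norm p (A y1) + lp_norm p (A y2)"
    using lp_diff(2)[OF bounded_ops_lp[OF A y(1)] bounded_ops_lp[OF A y(2)]]
      bounded_ops_scale[OF A d(1), of 2] lp_scale(2)[OF bounded_ops_lp[OF A d(1)], of 2] by simp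
  then have "r * op_norm p A / 2 \<le> lp_norm p (A y1) \<or> r * op_norm p A / 2 \<le> lp_norm p (A y2)"
    using d(3) by linarith
  then show ?thesis using y n by blast
qed

text \<open>A gliding hump in place of Baire's theorem: if the norms were unbounded, steps of length at most \<open>4\<^sup>-\<^sup>n\<close>, each making
  one chosen operator large, would add up to a point where the family is unbounded.  The steps after
  the \<open>n\<close>-th have total length at most \<open>4\<^sup>-\<^sup>n / 3\<close>, whereas step \<open>n\<close> makes the value of the \<open>n\<close>-th
  operator at least \<open>4\<^sup>-\<^sup>n / 2\<close> times its norm; the
  margin \<open>1/2 - 1/3 = 1/6\<close> is why the operators are chosen with norm above \<open>6 \<cdot> 4\<^sup>n n\<close>.\<close>

lemma uniform_boundedness:
  assumes F: "F \<subseteq> bounded_ops p" and pw: "\<And>x. x \<in> lp p \<Longrightarrow> \<exists>K. \<forall>A\<in>F. lp_norm p (A x) \<le> K"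
  shows "\<exists>K. \<forall>A\<in>F. op_norm p A \<le> K"
proof (rule ccontr)
  assume "\<not> ?thesis"
  then have "\<exists>A\<in>F. K < op_norm p A" for K by (meson not_le)
  then have "\<forall>n. \<exists>A. A \<in> F \<and> 6 * 4 ^ n * real n < op_norm p A" by blast
  from choice[OF this]
  obtain A where AF: "\<And>n::nat. A n \<in> F" and An: "\<And>n. 6 * 4 ^ n * real n < op_norm p (A n)"
    by blast
  have Ab: "A n \<in> bounded_ops p" for n using AF F by auto
  have "\<exists>X. \<forall>n. X n \<in> lp p \<and> (lp_norm p (\<lambda>k. X (Suc n) k - X n k) \<le> (1/4) ^ n
      \<and> (1/4) ^ n * op_norm p (A n) / 2 \<le> lp_norm p (A n (X (Suc n))))"
    using large_value_near[OF Ab] lp_zero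
    by (intro dependent_nat_choice[where P="\<lambda>n x. x \<in> lp p" and
          Q="\<lambda>n x y. lp_norm p (\<lambda>k. y k - x k) \<le> (1/4) ^ n \<and> (1/4) ^ n * op_norm p (A n) / 2 \<le> lp_norm p (A n y)"])
      (auto simp: Bex_def)
  then obtain X where X: "\<And>n. X n \<in> lp p" "\<And>n. lp_norm p (\<lambda>k. X (Suc n) k - X n k) \<le> (1/4) ^ n"
    "\<And>n. (1/4) ^ n * op_norm p (A n) / 2 \<le> lp_norm p (A n (X (Suc n)))" by blast
  have diff: "lp_norm p (\<lambda>k. X m k - X n k) \<le> 4/3 * ((1/4) ^ n - (1/4) ^ m)" if "n \<le> m" for m n
    using that
  proof (induction m rule: dec_induct)
    case base
    then show ?case using lp_zero by simp
  next
    case (step m)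
    have "lp_norm p (\<lambda>k. X (Suc m) k - X n k)
        \<le> lp_norm p (\<lambda>k. X (Suc m) k - X m k) + lp_norm p (\<lambda>k. X m k - X n k)"
      using lp_add(2)[OF lp_diff(1)[OF X(1)[of "Suc m"] X(1)[of m]] lp_diff(1)[OF X(1)[of m] X(1)[of n]]] by simp
    also have "\<dots> \<le> 4/3 * ((1/4) ^ n - (1/4) ^ Suc m)" using step.IH X(2)[of m] by simp
    finally show ?case .
  qed
  have diff': "lp_norm p (\<lambda>k. X m k - X n k) \<le> 4/3 * (1/4) ^ n" if "n \<le> m" for m n
    by (rule order_trans[OF diff[OF that]]) simp
  have "\<exists>l. (\<lambda>n. X n k) \<longlonglongrightarrow> l" for k
  proof -
    have "Cauchy (\<lambda>n. X n k)"
    proof (rule metric_CauchyI)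
      fix e :: real assume e: "0 < e"
      obtain N where "(1/4 :: real) ^ N < e / 4" using real_arch_pow_inv[of "e/4" "1/4"] e by auto
      then have N: "4/3 * (1/4 :: real) ^ N < e / 2" using e by linarith
      have half: "norm (X m k - X N k) < e / 2" if "m \<ge> N" for m
        using lp_coord_le[OF lp_diff(1)[OF X(1)[of m] X(1)[of N]], of k] diff'[OF that] N by linarith
      have "dist (X m k) (X n k) < e" if "m \<ge> N" "n \<ge> N" for m n
        using half[OF that(1)] half[OF that(2)] dist_triangle_half_r[of "X N k" "X m k" e "X n k"]
        by (simp add: dist_norm norm_minus_commute)
      then show "\<exists>N. \<forall>m\<ge>N. \<forall>n\<ge>N. dist (X m k) (X n k) < e" by blast
    qed
    then show ?thesis using Cauchy_convergent_iff convergent_def by blast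
  qed
  then obtain x where lim: "\<And>k. (\<lambda>n. X n k) \<longlonglongrightarrow> x k" by metis
  have rest: "(\<lambda>k. x k - X n k) \<in> lp p \<and> lp_norm p (\<lambda>k. x k - X n k) \<le> 4/3 * (1/4) ^ n" for n
  proof (rule conjI)
    have l: "(\<lambda>m. X m k - X n k) \<longlonglongrightarrow> x k - X n k" for k
      by (rule tendsto_diff[OF lim tendsto_const])
    show "(\<lambda>k. x k - X n k) \<in> lp p"
      by (rule lp_norm_pointwise_limit(1)[OF l lp_diff(1)[OF X(1) X(1)] diff'])
    show "lp_norm p (\<lambda>k. x k - X n k) \<le> 4/3 * (1/4) ^ n"
      by (rule lp_norm_pointwise_limit(2)[OF l lp_diff(1)[OF X(1) X(1)] diff'])
  qed
  have x: "x \<in> lp p" using lp_add(1)[OF conjunct1[OF rest[of 0]] X(1)[of 0]] by simp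
  obtain K where K: "\<And>A. A \<in> F \<Longrightarrow> lp_norm p (A x) \<le> K" using pw[OF x] by blast
  obtain n :: nat where n: "K < real n" using reals_Archimedean2 by blast
  define o_n where "o_n = op_norm p (A n)"
  have "lp_norm p (A n (X (Suc n))) - lp_norm p (A n (\<lambda>k. x k - X (Suc n) k)) \<le> lp_norm p (A n x)"
  proof -
    have "A n (X (Suc n)) = (\<lambda>k. A n x k - A n (\<lambda>k. x k - X (Suc n) k) k)"
      using bounded_ops_diff[OF Ab x conjunct1[OF rest[of "Suc n"]], of n] by simp
    then show ?thesis
      using lp_diff(2)[OF bounded_ops_lp[OF Ab x] bounded_ops_lp[OF Ab conjunct1[OF rest[of "Suc n"]]], of n n]
      by simp
  qed
  moreover have "lp_norm p (A n (\<lambda>k. x k - X (Suc n) k)) \<le> o_n * (4/3 * (1/4) ^ Suc n)"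
    using lp_norm_le_op_norm[OF Ab conjunct1[OF rest[of "Suc n"]], of n] rest[of "Suc n"] op_norm_nonneg[OF Ab[of n]]
    unfolding o_n_def by (meson mult_left_mono order_trans)
  moreover have "o_n * (4/3 * (1/4) ^ Suc n) = (1/4) ^ n * o_n / 3" by simp
  ultimately have "(1/4) ^ n * o_n / 6 \<le> lp_norm p (A n x)"
    using X(3)[of n] unfolding o_n_def[symmetric] by linarith
  moreover have "real n < (1/4) ^ n * o_n / 6"
    using An[of n] by (simp add: o_n_def power_divide field_simps)
  ultimately show False using K[OF AF[of n]] n by linarith
qed

end



section \<open>Strictly cyclic quasinilpotent weighted shifts\<close>

locale strictly_cyclic_shift = lp_exponent +
  fixes w :: "nat \<Rightarrow> complex" and T :: "(nat \<Rightarrow> complex) \<Rightarrow> nat \<Rightarrow> complex" and x\<^sub>0 :: "nat \<Rightarrow> complex"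
  assumes shift: "forward_weighted_shift p w T"
    and x0: "x\<^sub>0 \<in> lp p" and cyclic: "{A x\<^sub>0 | A. A \<in> wot_closed_algebra p T} = lp p"
    and quasinil: "quasinilpotent p T"
begin

lemma T_bounded: "T \<in> bounded_ops p"
  using shift by (simp add: forward_weighted_shift_def)

lemma T_basis_vec: "T (basis_vec n) = (\<lambda>k. w n * basis_vec (Suc n) k)"
  using shift by (simp add: forward_weighted_shift_def)

lemmas T_0 = weighted_shift_apply(1)[OF shift]
lemmas T_Suc = weighted_shift_apply(2)[OF shift]

text \<open>Strict cyclicity makes \<open>\<ell>\<^sup>p\<close> a commutative algebra with unit \<open>x\<^sub>0\<close>, and \<open>M y\<close> is multiplication by \<open>y\<close>.\<close>

definition M :: "(nat \<Rightarrow> complex) \<Rightarrow> (nat \<Rightarrow> complex) \<Rightarrow> nat \<Rightarrow> complex" where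
  "M y = (SOME A. A \<in> wot_closed_algebra p T \<and> A x\<^sub>0 = y)"

lemma
  assumes "y \<in> lp p"
  shows M_mem: "M y \<in> wot_closed_algebra p T" and M_x0: "M y x\<^sub>0 = y"
proof -
  have "\<exists>A. A \<in> wot_closed_algebra p T \<and> A x\<^sub>0 = y" 
    using assms[folded cyclic] by auto
  from someI_ex[OF this] show "M y \<in> wot_closed_algebra p T" "M y x\<^sub>0 = y"
    unfolding M_def by (rule conjunct1, rule conjunct2)
qed

lemma wot_closed_algebra_bounded: "A \<in> wot_closed_algebra p T \<Longrightarrow> A \<in> bounded_ops p"
  by (rule wot_closed_algebra_bicommutant(1)[OF T_bounded])

lemma wot_closed_algebra_comm_T:
  "A \<in> wot_closed_algebra p T \<Longrightarrow> x \<in> lp p \<Longrightarrow> A (T x) = T (A x)"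
  by (rule wot_closed_algebra_bicommutant(2)[OF T_bounded _ T_bounded]) auto

lemma M_bounded: "y \<in> lp p \<Longrightarrow> M y \<in> bounded_ops p"
  by (rule wot_closed_algebra_bounded[OF M_mem])

lemma M_lp: "y \<in> lp p \<Longrightarrow> u \<in> lp p \<Longrightarrow> M y u \<in> lp p"
  by (rule bounded_ops_lp[OF M_bounded])

lemma M_commute:
  assumes y: "y \<in> lp p" and u: "u \<in> lp p" shows "M y u = M u y"
proof -
  have "M y (M u x\<^sub>0) = M u (M y x\<^sub>0)"
    by (rule wot_closed_algebra_bicommutant(2)[OF T_bounded M_mem[OF y] M_bounded[OF u] _ x0])
      (rule wot_closed_algebra_comm_T[OF M_mem[OF u]])
  then show ?thesis by (simp add: M_x0 y u)
qed

text \<open>If \<open>w\<^sub>n = 0\<close>, then every \<open>T x\<close> vanishes at both \<open>0\<close> and \<open>n + 1\<close>, so each \<open>A \<in> \<A>(T)\<close> multiplies these two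
  coordinates of \<open>x\<^sub>0\<close> by the same number and cannot produce both \<open>e\<^sub>0\<close> and \<open>e\<^bsub>n+1\<^esub>\<close>.\<close>

lemma w_nonzero: "w n \<noteq> 0"
proof
  assume 0: "w n = 0"
  have coord: "A x\<^sub>0 k = A (basis_vec 0) 0 * x\<^sub>0 k" if "A \<in> wot_closed_algebra p T" "k \<in> {0, Suc n}" for A k
  proof (rule wot_closed_algebra_coord[OF T_bounded that(1) _ _ x0 that(2)])
    fix x k assume "k \<in> {0, Suc n}" "x \<in> lp p"
    then show "T x k = 0" using 0 T_0[of x] T_Suc[of x n] by fastforce
  qed simp
  define a b where "a = M (basis_vec 0) (basis_vec 0) 0" and "b = M (basis_vec (Suc n)) (basis_vec 0) 0"
  have "basis_vec 0 0 = a * x\<^sub>0 0" "basis_vec 0 (Suc n) = a * x\<^sub>0 (Suc n)"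
    using coord[OF M_mem[OF basis_vec_lp[of 0]]] unfolding M_x0[OF basis_vec_lp] a_def by blast+
  then have "x\<^sub>0 (Suc n) = 0" unfolding basis_vec_def by auto
  moreover have "basis_vec (Suc n) (Suc n) = b * x\<^sub>0 (Suc n)"
    using coord[OF M_mem[OF basis_vec_lp[of "Suc n"]]] unfolding M_x0[OF basis_vec_lp] b_def by blast
  ultimately show False by (simp add: basis_vec_def)
qed

text \<open>By \<open>M y u = M u y\<close>, the multiplications by the unit ball are bounded at each point \<open>u\<close>, namely by \<open>\<parallel>M u\<parallel>\<close>.\<close>

lemma M_norm_bound: "\<exists>C\<ge>0. \<forall>y\<in>lp p. \<forall>u\<in>lp p. lp_norm p (M y u) \<le> C * lp_norm p y * lp_norm p u"
proof -
  define F where "F = M ` {y \<in> lp p. lp_norm p y \<le> 1}"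
  have "\<exists>K. \<forall>A\<in>F. op_norm p A \<le> K"
  proof (rule uniform_boundedness)
    show "F \<subseteq> bounded_ops p" using M_bounded by (auto simp: F_def)
    fix u assume u: "u \<in> lp p"
    have "lp_norm p (M y u) \<le> op_norm p (M u)" if y: "y \<in> lp p" "lp_norm p y \<le> 1" for y
      using lp_norm_le_op_norm[OF M_bounded[OF u] y(1)] op_norm_nonneg[OF M_bounded[OF u]] y(2)
        M_commute[OF u y(1)] mult_left_le[OF y(2), of "op_norm p (M u)"] by simp
    then show "\<exists>K. \<forall>A\<in>F. lp_norm p (A u) \<le> K" by (auto simp: F_def)
  qed
  then obtain K where K: "\<And>y. y \<in> lp p \<Longrightarrow> lp_norm p y \<le> 1 \<Longrightarrow> op_norm p (M y) \<le> K"
    by (auto simp: F_def)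
  have K0: "0 \<le> K" using K[of "\<lambda>_. 0"] lp_zero op_norm_nonneg[OF M_bounded[of "\<lambda>_. 0"]] by auto
  have "lp_norm p (M y u) \<le> K * lp_norm p y * lp_norm p u" if y: "y \<in> lp p" and u: "u \<in> lp p" for y u
  proof (cases "y = (\<lambda>_. 0)")
    case True
    then show ?thesis
      using lp_norm_le_op_norm[OF M_bounded[OF u] y] lp_zero M_commute[OF y u] by simp
  next
    case False
    then have pos: "0 < lp_norm p y" by (rule lp_norm_pos[OF y])
    define v where "v = (\<lambda>n. complex_of_real (1 / lp_norm p y) * y n)"
    have v: "v \<in> lp p" "lp_norm p v = 1"
      using lp_scale[OF y, of "complex_of_real (1 / lp_norm p y)"] pos by (auto simp: v_def norm_divide)
    have yv: "y = (\<lambda>n. complex_of_real (lp_norm p y) * v n)" using pos by (simp add: v_def)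
    have "M y u = (\<lambda>n. complex_of_real (lp_norm p y) * M v u n)"
      unfolding M_commute[OF y u] M_commute[OF v(1) u]
      by (subst yv) (rule bounded_ops_scale[OF M_bounded[OF u] v(1)])
    then have "lp_norm p (M y u) = lp_norm p y * lp_norm p (M v u)"
      using lp_scale(2)[OF M_lp[OF v(1) u]] pos by simp
    also have "\<dots> \<le> lp_norm p y * (op_norm p (M v) * lp_norm p u)"
      using lp_norm_le_op_norm[OF M_bounded[OF v(1)] u] pos by simp
    also have "\<dots> \<le> lp_norm p y * (K * lp_norm p u)"
      using K[OF v(1)] v(2) pos lp_norm_nonneg[of u] by (simp add: mult_right_mono)
    finally show ?thesis by (simp add: mult_ac)
  qed
  then show ?thesis using K0 by blast
qed

abbreviation R :: "complex \<Rightarrow> (nat \<Rightarrow> complex) \<Rightarrow> nat \<Rightarrow> complex" where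
  "R \<equiv> resolvent p T"

lemma op_inverse_resolvent:
  assumes "z \<noteq> 0" shows "op_inverse p (shifted p T z) (R z)"
proof -
  have "z \<notin> op_spectrum p T" using quasinil assms by (simp add: quasinilpotent_def)
  then obtain Q where Q: "op_inverse p (shifted p T z) Q" by (auto simp: op_spectrum_def)
  have "Q' = Q" if Q': "op_inverse p (shifted p T z) Q'" for Q'
  proof (rule bounded_ops_eqI)
    show b: "Q' \<in> bounded_ops p" "Q \<in> bounded_ops p" using Q Q' by (auto simp: op_inverse_def)
    fix x assume x: "x \<in> lp p"
    have Qx: "Q x \<in> lp p" using bounded_ops_lp b x by blast
    have "shifted p T z (Q x) = x"
      using Q x by (auto simp: op_inverse_def op_id_def compose_def dest!: fun_cong[of _ _ x])
    moreover have "Q' (shifted p T z (Q x)) = Q x"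
      using Q' Qx by (auto simp: op_inverse_def op_id_def compose_def dest!: fun_cong[of _ _ "Q x"])
    ultimately show "Q' x = Q x" by simp
  qed
  then show ?thesis unfolding resolvent_def using Q by (metis (mono_tags, lifting) theI)
qed

lemma R_bounded: "z \<noteq> 0 \<Longrightarrow> R z \<in> bounded_ops p"
  using op_inverse_resolvent by (simp add: op_inverse_def)

lemma R_lp: "z \<noteq> 0 \<Longrightarrow> x \<in> lp p \<Longrightarrow> R z x \<in> lp p"
  by (rule bounded_ops_lp[OF R_bounded])

lemma R_right:
  assumes "z \<noteq> 0" "x \<in> lp p" shows "z * R z x n - T (R z x) n = x n"
proof -
  have "compose (lp p) (shifted p T z) (R z) x = op_id p x"
    using op_inverse_resolvent[OF assms(1)] by (simp add: op_inverse_def)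
  then have "(\<lambda>n. z * R z x n - T (R z x) n) = x"
    using assms(2) R_lp[OF assms] by (simp add: compose_def shifted_def op_id_def)
  then show ?thesis by (rule fun_cong)
qed

lemma R_eqI:
  assumes "z \<noteq> 0" "y \<in> lp p" "\<And>n. z * y n - T y n = v n" shows "R z v = y"
proof -
  have "compose (lp p) (R z) (shifted p T z) y = op_id p y"
    using op_inverse_resolvent[OF assms(1)] by (simp add: op_inverse_def)
  then have "R z (\<lambda>n. z * y n - T y n) = y"
    using assms(2) by (simp add: compose_def shifted_def op_id_def)
  then show ?thesis using assms(3) by simp
qed

lemma R_nonzero:
  assumes z: "z \<noteq> 0" and x: "x \<in> lp p" "x \<noteq> (\<lambda>_. 0)"
  shows "0 < lp_norm p (R z x)"
proof (rule lp_norm_pos[OF R_lp[OF z x(1)]])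
  show "R z x \<noteq> (\<lambda>_. 0)"
  proof
    assume 0: "R z x = (\<lambda>_. 0)"
    have "T (\<lambda>_. 0) = (\<lambda>_. 0)" using bounded_ops_scale[OF T_bounded lp_zero(1), of 0] by simp
    then show False using R_right[OF z x(1)] x(2) unfolding 0 by auto
  qed
qed

lemma R_commute_T:
  assumes z: "z \<noteq> 0" and x: "x \<in> lp p" shows "R z (T x) = T (R z x)"
proof (rule R_eqI[OF z bounded_ops_lp[OF T_bounded R_lp[OF z x]]])
  fix n
  note Rx = R_lp[OF z x]
  have "T x = T (\<lambda>n. z * R z x n - T (R z x) n)" using R_right[OF z x] by simp
  also have "\<dots> = (\<lambda>n. z * T (R z x) n - T (T (R z x)) n)"
    by (simp add: bounded_ops_diff[OF T_bounded lp_scale(1)[OF Rx] bounded_ops_lp[OF T_bounded Rx]]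
        bounded_ops_scale[OF T_bounded Rx])
  finally show "z * T (R z x) n - T (T (R z x)) n = T x n" by simp
qed

lemma R_commute_M:
  assumes z: "z \<noteq> 0" and y: "y \<in> lp p" and x: "x \<in> lp p" shows "M y (R z x) = R z (M y x)"
  by (rule wot_closed_algebra_bicommutant(2)[OF T_bounded M_mem[OF y] R_bounded[OF z] _ x])
    (rule R_commute_T[OF z])

text \<open>Conjugation by \<open>U\<^sub>u\<close> multiplies \<open>T\<close> by \<open>u\<close>, so \<open>R(z) U\<^sub>u = u U\<^sub>u R(z u)\<close>, and \<open>u U\<^sub>u\<close> preserves the norm.\<close>

lemma R_rotation:
  assumes z: "z \<noteq> 0" and u: "norm u = 1" and x: "x \<in> lp p"
  shows "lp_norm p (R z (\<lambda>k. u ^ k * x k)) = lp_norm p (R (z * u) x)"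
proof -
  have u0: "u \<noteq> 0" using u by auto
  define y where "y = (\<lambda>k. u ^ k * (u * R (z * u) x k))"
  have zu: "z * u \<noteq> 0" using z u0 by simp
  have uR: "(\<lambda>k. u * R (z * u) x k) \<in> lp p" by (intro lp_scale(1) R_lp zu x)
  have y: "y \<in> lp p" "lp_norm p y = lp_norm p (R (z * u) x)"
    using rotation_lp[OF uR u] lp_scale(2)[OF R_lp[OF zu x], of u] u by (auto simp: y_def)
  have "R z (\<lambda>k. u ^ k * x k) = y"
  proof (rule R_eqI[OF z y(1)])
    fix n
    note eq = R_right[OF zu x, of n]
    show "z * y n - T y n = u ^ n * x n"
    proof (cases n)
      case 0
      then show ?thesis using eq T_0[OF y(1)] T_0[OF R_lp[OF zu x]] by (simp add: y_def mult_ac)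
    next
      case (Suc k)
      have xk: "x (Suc k) = z * u * R (z * u) x (Suc k) - w k * R (z * u) x k"
        using eq T_Suc[OF R_lp[OF zu x], of k] Suc by simp
      have Ty: "T y (Suc k) = w k * (u ^ k * (u * R (z * u) x k))"
        using T_Suc[OF y(1), of k] by (simp add: y_def)
      show ?thesis unfolding Suc Ty xk by (simp add: y_def algebra_simps)
    qed
  qed
  then show ?thesis using y(2) by simp
qed

lemma R_rotation_basis_vec:
  assumes z: "z \<noteq> 0" and u: "norm u = 1"
  shows "lp_norm p (R (z * u) (basis_vec 0)) = lp_norm p (R z (basis_vec 0))"
proof -
  have "(\<lambda>k. u ^ k * basis_vec 0 k) = basis_vec 0" by (auto simp: basis_vec_def)
  then show ?thesis using R_rotation[OF z u basis_vec_lp[of 0]] by simp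
qed

text \<open>With \<open>A = M e\<^sub>0\<close> one has \<open>R(z) (A v) = M v (R(z) e\<^sub>0)\<close>, which is at most \<open>C \<parallel>v\<parallel> \<parallel>R(z) e\<^sub>0\<parallel>\<close> in norm.  The right-hand
  side is unchanged when \<open>A\<close> is conjugated by a rotation, because \<open>e\<^sub>0\<close> is fixed, so the estimate survives
  averaging, which replaces \<open>A\<close> by its constant diagonal entry \<open>a\<close>.  The averaging lemma handles finitely
  many columns; truncations of \<open>v\<close> suffice by density.\<close>

lemma op_norm_R_le: "\<exists>K>0. \<forall>z. z \<noteq> 0 \<longrightarrow> op_norm p (R z) \<le> K * lp_norm p (R z (basis_vec 0))"
proof -
  define e :: "nat \<Rightarrow> nat \<Rightarrow> complex" where "e = basis_vec"
  have e_lp: "e i \<in> lp p" for i by (simp add: e_def basis_vec_lp)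
  define A where "A = M (e 0)"
  define a where "a = A (e 0) 0"
  note Ab = M_bounded[OF e_lp[of 0], folded A_def]
  obtain C where C0: "C \<ge> 0" and C: "\<And>y u. y \<in> lp p \<Longrightarrow> u \<in> lp p \<Longrightarrow>
      lp_norm p (M y u) \<le> C * lp_norm p y * lp_norm p u" using M_norm_bound by blast
  have a0: "a \<noteq> 0"
  proof -
    have "A x\<^sub>0 0 = A (e 0) 0 * x\<^sub>0 0" unfolding A_def
      using wot_closed_algebra_coord[OF T_bounded M_mem[OF e_lp] _ _ x0, of "{0}"] T_0
      by (simp add: e_def)
    then show ?thesis using M_x0[OF e_lp[of 0]] by (auto simp: A_def a_def e_def basis_vec_def)
  qed
  \<comment> \<open>\<open>A T = T A\<close> carries the diagonal entry from \<open>j\<close> to \<open>j + 1\<close>, as \<open>w\<^sub>j \<noteq> 0\<close>.\<close>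
  have diag: "A (e j) j = a" for j
  proof (induction j)
    case 0
    then show ?case by (simp add: a_def)
  next
    case (Suc j)
    have "A (T (e j)) = T (A (e j))"
      unfolding A_def by (rule wot_closed_algebra_comm_T[OF M_mem[OF e_lp] e_lp])
    also have "A (T (e j)) = (\<lambda>k. w j * A (e (Suc j)) k)"
      using bounded_ops_scale[OF Ab e_lp[of "Suc j"], of "w j"] by (simp add: T_basis_vec[folded e_def])
    finally have "w j * A (e (Suc j)) (Suc j) = w j * A (e j) j"
      using T_Suc[OF bounded_ops_lp[OF Ab e_lp[of j]], of j] by (metis)
    then show ?case using Suc w_nonzero by simp
  qed
  have RA: "lp_norm p (R z (A v)) \<le> C * lp_norm p v * lp_norm p (R z (e 0))"
    if z: "z \<noteq> 0" and v: "v \<in> lp p" for z v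
    using C[OF v R_lp[OF z e_lp]] unfolding A_def M_commute[OF e_lp v] R_commute_M[OF z v e_lp] .
  have "lp_norm p (R z v) \<le> C / norm a * lp_norm p (R z (e 0)) * lp_norm p v"
    if z: "z \<noteq> 0" and v: "v \<in> lp p" for z v
  proof (rule bounded_ops_truncation_norm_le[OF R_bounded[OF z] v])
    fix N
    let ?t = "\<lambda>k. if k < N then v k else 0"
    have t: "?t \<in> lp p" by (rule truncation_lp[OF v])
    have "lp_norm p (R z (\<lambda>k. if k \<in> {..<N} then v k * A (e k) k else 0))
        \<le> C * lp_norm p v * lp_norm p (R z (e 0))"
    proof (rule norm_diagonal_le[OF R_bounded[OF z], of "{..<N}" "\<lambda>i k. v i * A (e i) k"])
      show "(\<lambda>k. v i * A (e i) k) \<in> lp p" for i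
        by (intro lp_scale(1) bounded_ops_lp[OF Ab e_lp])
      fix u :: complex assume u: "norm u = 1"
      define v' where "v' = (\<lambda>k. if k < N then cnj u ^ k * v k else 0)"
      have "norm (v' k) \<le> norm (v k)" for k using u by (simp add: v'_def norm_mult norm_power)
      note v' = lp_mono[OF v this]
      have "A v' = (\<lambda>k. \<Sum>i<N. cnj u ^ i * v i * A (e i) k)"
        unfolding v'_def e_def by (rule bounded_ops_truncation[OF Ab])
      then have "(\<lambda>k. \<Sum>i<N. cnj u ^ i * u ^ k * (v i * A (e i) k)) = (\<lambda>k. u ^ k * A v' k)"
        by (simp add: sum_distrib_left mult_ac)
      then have "lp_norm p (R z (\<lambda>k. \<Sum>i<N. cnj u ^ i * u ^ k * (v i * A (e i) k)))
          = lp_norm p (R (z * u) (A v'))"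
        using R_rotation[OF z u bounded_ops_lp[OF Ab v'(1)]] by simp
      also have "\<dots> \<le> C * lp_norm p v' * lp_norm p (R (z * u) (e 0))"
        using z u by (intro RA v'(1)) auto
      also have "\<dots> \<le> C * lp_norm p v * lp_norm p (R z (e 0))"
        unfolding e_def R_rotation_basis_vec[OF z u]
        by (intro mult_right_mono mult_left_mono v'(2) C0 lp_norm_nonneg)
      finally show "lp_norm p (R z (\<lambda>k. \<Sum>i<N. cnj u ^ i * u ^ k * (v i * A (e i) k)))
          \<le> C * lp_norm p v * lp_norm p (R z (e 0))" .
    qed simp
    also have "(\<lambda>k. if k \<in> {..<N} then v k * A (e k) k else 0) = (\<lambda>k. a * ?t k)"
      by (auto simp: diag)
    finally have "norm a * lp_norm p (R z ?t) \<le> C * lp_norm p v * lp_norm p (R z (e 0))"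
      using bounded_ops_scale[OF R_bounded[OF z] t, of a] lp_scale(2)[OF R_lp[OF z t], of a] by simp
    then show "lp_norm p (R z ?t) \<le> C / norm a * lp_norm p (R z (e 0)) * lp_norm p v"
      using a0 by (simp add: field_simps)
  qed
  then have "op_norm p (R z) \<le> C / norm a * lp_norm p (R z (e 0))" if "z \<noteq> 0" for z
    using that C0 lp_norm_nonneg by (intro op_norm_le) auto
  also have "C / norm a * lp_norm p (R z (e 0)) \<le> (C / norm a + 1) * lp_norm p (R z (e 0))" for z
    using lp_norm_nonneg by (intro mult_right_mono) auto
  \<comment> \<open>The summand \<open>1\<close> keeps the constant positive, as its logarithm is taken later.\<close>
  finally show ?thesis using C0 a0
    by (intro exI[of _ "C / norm a + 1"]) (auto simp: e_def add_nonneg_pos)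
qed

text \<open>The left-hand side is the modulus of the \<open>n\<close>-th coordinate of \<open>R(z) e\<^sub>0\<close>, found by solving
  \<open>z y - T y = e\<^sub>0\<close> one coordinate at a time.\<close>

lemma norm_R_basis_0_ge:
  assumes z: "z \<noteq> 0"
  shows "(\<Prod>i<n. norm (w i)) / norm z ^ Suc n \<le> lp_norm p (R z (basis_vec 0))"
proof -
  define y where "y = R z (basis_vec 0)"
  have y: "y \<in> lp p" by (simp add: y_def R_lp z basis_vec_lp)
  note eq = R_right[OF z basis_vec_lp[of 0], folded y_def]
  have "norm (y n) = (\<Prod>i<n. norm (w i)) / norm z ^ Suc n" for n
  proof (induction n)
    case 0
    have "z * y 0 = 1" using eq[of 0] T_0[OF y] by (simp add: basis_vec_def)
    then have "norm z * norm (y 0) = 1" by (metis norm_mult norm_one)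
    then show ?case using z by (simp add: field_simps)
  next
    case (Suc n)
    have "z * y (Suc n) = w n * y n" using eq[of "Suc n"] T_Suc[OF y] by (simp add: basis_vec_def)
    then have "norm z * norm (y (Suc n)) = norm (w n) * norm (y n)" by (metis norm_mult)
    then show ?case using z Suc by (simp add: field_simps)
  qed
  then show ?thesis using lp_coord_le[OF y, of n] by (simp add: y_def)
qed

text \<open>Applying \<open>T R(z) = z R(z) - 1\<close> to \<open>e\<^sub>m\<close> gives \<open>w\<^sub>m R(z) e\<^bsub>m+1\<^esub> = z R(z) e\<^sub>m - e\<^sub>m\<close>; each index thus costs a
  factor \<open>\<bar>z\<bar>\<close> and a bounded error.\<close>

lemma norm_R_basis_vec_ge:
  "\<exists>c>0. \<exists>D. \<forall>z. z \<noteq> 0 \<longrightarrow> norm z \<le> 1 \<longrightarrow>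
     c * norm z ^ m * lp_norm p (R z (basis_vec 0)) - D \<le> lp_norm p (R z (basis_vec m))"
proof (induction m)
  case 0
  then show ?case by (intro exI[of _ 1] conjI exI[of _ 0]) auto
next
  case (Suc m)
  then obtain c D where c: "c > 0" and D: "\<And>z. z \<noteq> 0 \<Longrightarrow> norm z \<le> 1 \<Longrightarrow>
      c * norm z ^ m * lp_norm p (R z (basis_vec 0)) - D \<le> lp_norm p (R z (basis_vec m))" by blast
  have wp: "0 < norm (w m)" using w_nonzero by simp
  have "c / norm (w m) * norm z ^ Suc m * lp_norm p (R z (basis_vec 0)) - (\<bar>D\<bar> + 1) / norm (w m)
      \<le> lp_norm p (R z (basis_vec (Suc m)))" if z: "z \<noteq> 0" "norm z \<le> 1" for z
  proof -
    note Rm = R_lp[OF z(1) basis_vec_lp[of m]]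
    have "(\<lambda>k. z * R z (basis_vec m) k - basis_vec m k) = T (R z (basis_vec m))"
      using R_right[OF z(1) basis_vec_lp[of m]] by (auto simp: algebra_simps)
    also have "\<dots> = R z (T (basis_vec m))" by (rule R_commute_T[OF z(1) basis_vec_lp, symmetric])
    also have "\<dots> = (\<lambda>k. w m * R z (basis_vec (Suc m)) k)"
      unfolding T_basis_vec by (rule bounded_ops_scale[OF R_bounded[OF z(1)] basis_vec_lp])
    finally have "lp_norm p (\<lambda>k. z * R z (basis_vec m) k - basis_vec m k)
        = norm (w m) * lp_norm p (R z (basis_vec (Suc m)))"
      using lp_scale(2)[OF R_lp[OF z(1) basis_vec_lp[of "Suc m"]]] by simp
    then have "norm z * lp_norm p (R z (basis_vec m)) - 1 \<le> norm (w m) * lp_norm p (R z (basis_vec (Suc m)))"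
      using lp_norm_diff_ge[OF lp_scale(1)[OF Rm, of z] basis_vec_lp[of m]]
      by (simp add: lp_scale(2)[OF Rm] lp_norm_basis_vec)
    moreover have "norm z * (c * norm z ^ m * lp_norm p (R z (basis_vec 0)) - D)
        \<le> norm z * lp_norm p (R z (basis_vec m))" by (intro mult_left_mono D z) simp
    moreover have "norm z * D \<le> \<bar>D\<bar>"
      using mult_left_le[of "norm z" "\<bar>D\<bar>"] z(2) abs_ge_self[of D]
      by (smt (verit) mult.commute mult_left_mono norm_ge_zero)
    ultimately have "c * norm z ^ Suc m * lp_norm p (R z (basis_vec 0)) - (\<bar>D\<bar> + 1)
        \<le> norm (w m) * lp_norm p (R z (basis_vec (Suc m)))"
      by (simp add: algebra_simps)
    then show ?thesis using wp by (simp add: field_simps)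
  qed
  then show ?case using c wp by (intro exI[of _ "c / norm (w m)"] conjI exI[of _ "(\<bar>D\<bar> + 1) / norm (w m)"]) auto
qed

text \<open>If \<open>\<parallel>R(z') x\<parallel>\<close>, which is \<open>\<parallel>R(z) U\<^sub>u x\<parallel>\<close> for \<open>z' = z u\<close>, were smaller than this all around the circle, averaging
  \<open>u\<^sup>-\<^sup>m U\<^sub>u x\<close> to \<open>x\<^sub>m e\<^sub>m\<close> would give \<open>\<bar>x\<^sub>m\<bar> \<parallel>R(z) e\<^sub>m\<parallel> \<le> \<bar>x\<^sub>m\<bar> \<parallel>R(z) e\<^sub>m\<parallel> / 2\<close>.\<close>

lemma R_large_on_circle:
  assumes z: "z \<noteq> 0" and x: "x \<in> lp p" and xm: "x m \<noteq> 0"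
  shows "\<exists>z'. norm z' = norm z \<and> norm (x m) / 2 * lp_norm p (R z (basis_vec m)) \<le> lp_norm p (R z' x)"
proof (rule ccontr)
  assume "\<not> ?thesis"
  then have small: "lp_norm p (R z' x) \<le> norm (x m) / 2 * lp_norm p (R z (basis_vec m))"
    if "norm z' = norm z" for z' using that by (auto simp: not_le intro: less_imp_le)
  have "lp_norm p (R z (\<lambda>k. if k \<in> {m} then x k else 0)) \<le> norm (x m) / 2 * lp_norm p (R z (basis_vec m))"
  proof (rule norm_diagonal_le[OF R_bounded[OF z], of _ "\<lambda>_. x"])
    fix u :: complex assume u: "norm u = 1"
    note ux = rotation_lp(1)[OF x u]
    have "R z (\<lambda>k. \<Sum>i\<in>{m}. cnj u ^ i * u ^ k * x k) = (\<lambda>k. cnj u ^ m * R z (\<lambda>k. u ^ k * x k) k)"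
      using bounded_ops_scale[OF R_bounded[OF z] ux, of "cnj u ^ m"] by (simp add: mult.assoc)
    then have "lp_norm p (R z (\<lambda>k. \<Sum>i\<in>{m}. cnj u ^ i * u ^ k * x k)) = lp_norm p (R (z * u) x)"
      using lp_scale(2)[OF R_lp[OF z ux], of "cnj u ^ m"] u R_rotation[OF z u x] by (simp add: norm_power)
    also have "\<dots> \<le> norm (x m) / 2 * lp_norm p (R z (basis_vec m))"
      using u by (intro small) (simp add: norm_mult)
    finally show "lp_norm p (R z (\<lambda>k. \<Sum>i\<in>{m}. cnj u ^ i * u ^ k * x k))
        \<le> norm (x m) / 2 * lp_norm p (R z (basis_vec m))" .
  qed (use x in auto)
  also have "(\<lambda>k. if k \<in> {m} then x k else 0) = (\<lambda>k. x m * basis_vec m k)"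
    by (auto simp: basis_vec_def)
  finally have le: "norm (x m) * lp_norm p (R z (basis_vec m)) \<le> norm (x m) / 2 * lp_norm p (R z (basis_vec m))"
    by (simp add: bounded_ops_scale[OF R_bounded[OF z] basis_vec_lp] lp_scale(2)[OF R_lp[OF z basis_vec_lp]])
  have "0 < lp_norm p (R z (basis_vec m))" by (rule R_nonzero[OF z basis_vec_lp basis_vec_nonzero])
  then show False using le xm by simp
qed


section \<open>Logarithmic growth of the resolvent\<close>

abbreviation L :: "complex \<Rightarrow> real" where
  "L z \<equiv> ln (lp_norm p (R z (basis_vec 0)))"

lemma R_basis_pos: "z \<noteq> 0 \<Longrightarrow> 0 < lp_norm p (R z (basis_vec 0))"
  by (rule R_nonzero[OF _ basis_vec_lp basis_vec_nonzero])

lemma L_ge: "\<exists>C. \<forall>z. z \<noteq> 0 \<longrightarrow> real (Suc n) * (- ln (norm z)) - C \<le> L z"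
proof (intro exI allI impI)
  fix z :: complex assume z: "z \<noteq> 0"
  have P: "0 < (\<Prod>i<n. norm (w i))" using w_nonzero by (simp add: prod_pos)
  have "ln ((\<Prod>i<n. norm (w i)) / norm z ^ Suc n) \<le> L z"
    using norm_R_basis_0_ge[OF z, of n] P z by (subst ln_le_cancel_iff) (auto simp: R_basis_pos)
  moreover have "ln ((\<Prod>i<n. norm (w i)) / norm z ^ Suc n) = ln (\<Prod>i<n. norm (w i)) - real (Suc n) * ln (norm z)"
    using P z by (subst ln_div) (simp_all add: ln_realpow w_nonzero del: power_Suc of_nat_Suc)
  ultimately show "real (Suc n) * (- ln (norm z)) - (- ln (\<Prod>i<n. norm (w i))) \<le> L z" by simp
qed

lemma filterlim_minus_ln_norm: "filterlim (\<lambda>z::complex. - ln (norm z)) at_top (at 0)"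
proof -
  have "filterlim (\<lambda>z::complex. norm z) (at_right 0) (at 0)"
    unfolding filterlim_at by (auto intro!: tendsto_norm_zero tendsto_ident_at simp: eventually_at_filter)
  then have "filterlim (\<lambda>z::complex. ln (norm z)) at_bot (at 0)"
    by (rule filterlim_compose[OF ln_at_0])
  then show ?thesis by (simp add: filterlim_uminus_at_bot)
qed

lemma filterlim_L: "filterlim L at_top (at 0)"
proof -
  obtain C where C: "\<And>z. z \<noteq> 0 \<Longrightarrow> - ln (norm z) - C \<le> L z" using L_ge[of 0] by auto
  have "filterlim (\<lambda>z::complex. - C + - ln (norm z)) at_top (at 0)"
    by (rule filterlim_tendsto_add_at_top[OF tendsto_const filterlim_minus_ln_norm])
  moreover have "\<forall>\<^sub>F z in at 0. - C + - ln (norm z) \<le> L z"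
    unfolding eventually_at_filter
  proof (intro always_eventually allI impI)
    fix z :: complex assume "z \<noteq> 0"
    then show "- C + - ln (norm z) \<le> L z" using C[of z] by simp
  qed
  ultimately show ?thesis by (rule filterlim_at_top_mono)
qed

text \<open>\<open>L z\<close> is at least \<open>(n + 1) ln (1/\<bar>z\<bar>)\<close> up to a constant; choose \<open>n\<close> large compared with \<open>m / \<epsilon>\<close>.\<close>

lemma ln_norm_negligible:
  assumes "0 < \<epsilon>" shows "\<forall>\<^sub>F z in at 0. real m * (- ln (norm z)) \<le> \<epsilon> * L z"
proof -
  obtain n where n: "2 * real m / \<epsilon> < real n" using reals_Archimedean2 by blast
  obtain C where C: "\<And>z. z \<noteq> 0 \<Longrightarrow> real (Suc n) * (- ln (norm z)) - C \<le> L z" using L_ge[of n] by blast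
  have "\<forall>\<^sub>F z in at 0. C \<le> L z" using filterlim_L by (simp add: filterlim_at_top)
  moreover have "\<forall>\<^sub>F z in at (0::complex). 0 \<le> - ln (norm z)"
    using filterlim_minus_ln_norm unfolding filterlim_at_top by blast
  moreover have "\<forall>\<^sub>F z in at (0::complex). z \<noteq> 0" by (simp add: eventually_at_filter)
  ultimately show ?thesis
  proof eventually_elim
    case (elim z)
    have "2 * real m / \<epsilon> * (- ln (norm z)) \<le> real (Suc n) * (- ln (norm z))"
      using n elim by (intro mult_right_mono) auto
    also have "\<dots> \<le> 2 * L z" using C[of z] elim by simp
    finally show ?case using assms by (simp add: field_simps)
  qed
qed

text \<open>Both the factor \<open>c \<bar>z\<bar>\<^sup>m\<close> and the constant \<open>D\<close> cost less than the factor \<open>exp (\<epsilon> L z)\<close>.\<close>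

lemma lower_growth:
  assumes \<epsilon>: "0 < \<epsilon>" "\<epsilon> < 1" and c: "0 < c"
  shows "\<forall>\<^sub>F z in at 0. exp ((1 - \<epsilon>) * L z) \<le> c * norm z ^ m * lp_norm p (R z (basis_vec 0)) - D"
proof -
  have "filterlim (\<lambda>z. (1 - \<epsilon>) * L z) at_top (at 0)"
    using \<epsilon> by (intro filterlim_tendsto_pos_mult_at_top[OF tendsto_const _ filterlim_L]) auto
  then have "filterlim (\<lambda>z. exp ((1 - \<epsilon>) * L z)) at_top (at 0)"
    by (rule filterlim_compose[OF exp_at_top])
  then have "\<forall>\<^sub>F z in at 0. D \<le> exp ((1 - \<epsilon>) * L z)" by (simp add: filterlim_at_top)
  moreover have "filterlim (\<lambda>z. \<epsilon> / 2 * L z) at_top (at 0)"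
    using \<epsilon> by (intro filterlim_tendsto_pos_mult_at_top[OF tendsto_const _ filterlim_L]) auto
  then have "\<forall>\<^sub>F z in at 0. ln (2 / c) \<le> \<epsilon> / 2 * L z" by (simp add: filterlim_at_top)
  moreover have "\<forall>\<^sub>F z in at 0. real m * (- ln (norm z)) \<le> \<epsilon> / 2 * L z"
    using \<epsilon> by (intro ln_norm_negligible) auto
  moreover have "\<forall>\<^sub>F z in at (0::complex). z \<noteq> 0" by (simp add: eventually_at_filter)
  ultimately show ?thesis
  proof eventually_elim
    case (elim z)
    have "ln 2 + (1 - \<epsilon>) * L z \<le> ln c + real m * ln (norm z) + L z"
      using elim c by (simp add: ln_div algebra_simps)
    also have "\<dots> = ln (c * norm z ^ m * lp_norm p (R z (basis_vec 0)))"
      using c elim R_basis_pos[of z] by (simp add: ln_mult ln_realpow)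
    finally have "exp (ln 2 + (1 - \<epsilon>) * L z) \<le> exp (ln (c * norm z ^ m * lp_norm p (R z (basis_vec 0))))"
      by simp
    then have "2 * exp ((1 - \<epsilon>) * L z) \<le> c * norm z ^ m * lp_norm p (R z (basis_vec 0))"
      using c elim R_basis_pos[of z] by (simp add: exp_add)
    then show ?case using elim by linarith
  qed
qed

lemma L_rotation:
  assumes "z \<noteq> 0" "norm z' = norm z" shows "L z' = L z"
  using R_rotation_basis_vec[of z "z' / z"] assms by (simp add: norm_divide)

lemma basis_norm_le_op_norm:
  assumes "z \<noteq> 0" shows "lp_norm p (R z (basis_vec 0)) \<le> op_norm p (R z)"
  using lp_norm_le_op_norm[OF R_bounded[OF assms] basis_vec_lp[of 0]] by (simp add: lp_norm_basis_vec)

lemma L_le_ln_op_norm: "z \<noteq> 0 \<Longrightarrow> L z \<le> ln (op_norm p (R z))"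
  using basis_norm_le_op_norm[of z] R_basis_pos[of z] by simp

text \<open>\<open>ln \<parallel>R(z) x\<parallel> \<le> ln \<parallel>R(z)\<parallel> + ln \<parallel>x\<parallel>\<close>, and the last summand is negligible because \<open>ln \<parallel>R(z)\<parallel> \<ge> L z \<rightarrow> \<infinity>\<close>.\<close>

lemma local_exponent_le_1:
  assumes x: "x \<in> lp p" "x \<noteq> (\<lambda>_. 0)"
  shows "local_exponent p T x \<le> 1"
  unfolding local_exponent_def Limsup_le_iff
proof (intro allI impI)
  fix y :: ereal assume y: "1 < y"
  obtain r :: real where r: "1 < r" "ereal r \<le> y"
    using y by (cases y) (auto simp: one_ereal_def intro: that[of 2])
  have "\<forall>\<^sub>F z in at 0. ln (lp_norm p x) / (r - 1) < L z"
    using filterlim_L by (simp add: filterlim_at_top_dense)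
  moreover have "\<forall>\<^sub>F z in at 0. 0 < L z" using filterlim_L by (simp add: filterlim_at_top_dense)
  moreover have "\<forall>\<^sub>F z in at (0::complex). z \<noteq> 0" by (simp add: eventually_at_filter)
  ultimately show "\<forall>\<^sub>F z in at 0. ereal (ln (lp_norm p (R z x)) / ln (op_norm p (R z))) < y"
  proof eventually_elim
    case (elim z)
    let ?b = "op_norm p (R z)"
    have b: "0 < ?b" using R_basis_pos[of z] basis_norm_le_op_norm[of z] elim by linarith
    have lb: "L z \<le> ln ?b" by (rule L_le_ln_op_norm) (use elim in auto)
    have "ln (lp_norm p (R z x)) \<le> ln (?b * lp_norm p x)"
      using lp_norm_le_op_norm[OF R_bounded[OF elim(3)] x(1)] R_nonzero[OF elim(3) x] by simp
    also have "\<dots> = ln ?b + ln (lp_norm p x)" using b lp_norm_pos[OF x] by (simp add: ln_mult)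
    also have "\<dots> < r * ln ?b"
    proof -
      have "ln (lp_norm p x) < (r - 1) * L z" using elim r by (simp add: field_simps)
      also have "\<dots> \<le> (r - 1) * ln ?b" using lb r by (intro mult_left_mono) auto
      finally show ?thesis by (simp add: algebra_simps)
    qed
    finally have "ln (lp_norm p (R z x)) / ln ?b < r"
      using lb elim by (simp add: pos_divide_less_eq)
    then show ?case using r(2) by (meson ereal_less(2) less_ereal.simps(1) less_le_trans)
  qed
qed

text \<open>On each small circle some \<open>z'\<close> satisfies \<open>ln \<parallel>R(z') x\<parallel> \<ge> (1 - \<epsilon>) L z\<close>, while \<open>ln \<parallel>R(z')\<parallel> \<le> (1 + \<epsilon>) L z\<close> holds
  everywhere near \<open>0\<close>; here \<open>L\<close> is constant on circles.  Only one point per circle is controlled, so the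
  estimate holds frequently and not eventually.\<close>

lemma log_ratio_frequently_large:
  assumes x: "x \<in> lp p" "x \<noteq> (\<lambda>_. 0)" and \<epsilon>: "0 < \<epsilon>" "\<epsilon> < 1"
  shows "\<exists>\<^sub>F z in at 0. (1 - \<epsilon>) / (1 + \<epsilon>) \<le> ln (lp_norm p (R z x)) / ln (op_norm p (R z))"
proof -
  obtain m where m: "x m \<noteq> 0" using x(2) by auto
  obtain K where K: "0 < K" "\<And>z. z \<noteq> 0 \<Longrightarrow> op_norm p (R z) \<le> K * lp_norm p (R z (basis_vec 0))"
    using op_norm_R_le by blast
  obtain c D where c: "0 < c" and D: "\<And>z. z \<noteq> 0 \<Longrightarrow> norm z \<le> 1 \<Longrightarrow>
     c * norm z ^ m * lp_norm p (R z (basis_vec 0)) - D \<le> lp_norm p (R z (basis_vec m))"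
    using norm_R_basis_vec_ge by metis
  define \<xi> where "\<xi> = norm (x m) / 2"
  have \<xi>: "0 < \<xi>" using m by (simp add: \<xi>_def)
  define good where "good z \<longleftrightarrow> (1 - \<epsilon>) / (1 + \<epsilon>) \<le> ln (lp_norm p (R z x)) / ln (op_norm p (R z))" for z
  have "\<forall>\<^sub>F z in at 0. exp ((1 - \<epsilon>) * L z) \<le> (\<xi> * c) * norm z ^ m * lp_norm p (R z (basis_vec 0)) - \<xi> * D"
    using \<epsilon> c \<xi> by (intro lower_growth) auto
  moreover have "\<forall>\<^sub>F z in at 0. ln K / \<epsilon> \<le> L z" using filterlim_L by (simp add: filterlim_at_top)
  moreover have "\<forall>\<^sub>F z in at 0. 0 < L z" using filterlim_L by (simp add: filterlim_at_top_dense)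
  moreover have "\<forall>\<^sub>F z in at (0::complex). z \<noteq> 0" by (simp add: eventually_at_filter)
  moreover have "\<forall>\<^sub>F z in at (0::complex). norm z \<le> 1"
    by (auto simp: eventually_at intro!: exI[of _ 1])
  ultimately have "\<forall>\<^sub>F z in at (0::complex). z \<noteq> 0 \<and> (\<exists>z'. norm z' = norm z \<and> good z')"
  proof eventually_elim
    case (elim z)
    obtain z' where z': "norm z' = norm z"
      and ge: "\<xi> * lp_norm p (R z (basis_vec m)) \<le> lp_norm p (R z' x)"
      using R_large_on_circle[OF elim(4) x(1) m] by (auto simp: \<xi>_def)
    have z'0: "z' \<noteq> 0" using z' elim(4) by auto
    have Lz: "L z' = L z" by (rule L_rotation[OF elim(4) z'])
    have "exp ((1 - \<epsilon>) * L z) \<le> \<xi> * (c * norm z ^ m * lp_norm p (R z (basis_vec 0)) - D)"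
      using elim(1) by (simp add: algebra_simps)
    also have "\<dots> \<le> \<xi> * lp_norm p (R z (basis_vec m))"
      using \<xi> by (intro mult_left_mono D elim) auto
    also note ge
    finally have a: "(1 - \<epsilon>) * L z \<le> ln (lp_norm p (R z' x))"
      using R_nonzero[OF z'0 x] by (subst ln_ge_iff) auto
    have "0 < op_norm p (R z')"
      using R_basis_pos[OF z'0] basis_norm_le_op_norm[OF z'0] by linarith
    then have "ln (op_norm p (R z')) \<le> ln (K * lp_norm p (R z' (basis_vec 0)))"
      using K(2)[OF z'0] by simp
    also have "\<dots> = ln K + L z" using K(1) R_basis_pos[OF z'0] Lz by (simp add: ln_mult)
    also have "\<dots> \<le> (1 + \<epsilon>) * L z" using elim(2) \<epsilon> by (simp add: field_simps)
    finally have b: "ln (op_norm p (R z')) \<le> (1 + \<epsilon>) * L z" .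
    have b0: "0 < ln (op_norm p (R z'))" using L_le_ln_op_norm[OF z'0] Lz elim(3) by simp
    have "(1 - \<epsilon>) / (1 + \<epsilon>) * ln (op_norm p (R z')) \<le> (1 - \<epsilon>) / (1 + \<epsilon>) * ((1 + \<epsilon>) * L z)"
      using b \<epsilon> by (intro mult_left_mono) auto
    also have "\<dots> = (1 - \<epsilon>) * L z" using \<epsilon> by simp
    finally have "good z'" unfolding good_def using a b0 by (simp add: pos_le_divide_eq)
    then show ?case using z' elim(4) by blast
  qed
  then obtain d where d: "0 < d"
    "\<And>z::complex. z \<noteq> 0 \<Longrightarrow> norm z < d \<Longrightarrow> \<exists>z'. norm z' = norm z \<and> good z'"
    by (auto simp: eventually_at)
  have "\<exists>\<^sub>F z in at 0. good z"
    unfolding frequently_def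
  proof
    assume "\<forall>\<^sub>F z in at 0. \<not> good z"
    then obtain d' where d': "0 < d'" "\<And>z. z \<noteq> 0 \<Longrightarrow> norm z < d' \<Longrightarrow> \<not> good z"
      by (auto simp: eventually_at)
    define z where "z = complex_of_real (min d d' / 2)"
    have z: "z \<noteq> 0" "norm z < d" "norm z < d'" using d(1) d'(1) by (auto simp: z_def)
    obtain z' where "norm z' = norm z" "good z'" using d(2)[OF z(1,2)] by blast
    moreover have "z' \<noteq> 0" using calculation(1) z(1) by (metis norm_eq_zero)
    ultimately show False using d'(2)[of z'] z by simp
  qed
  then show ?thesis by (simp add: good_def)
qed

lemma local_exponent_ge_1:
  assumes x: "x \<in> lp p" "x \<noteq> (\<lambda>_. 0)"
  shows "1 \<le> local_exponent p T x"
proof (rule ccontr)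
  let ?f = "\<lambda>z. ereal (ln (lp_norm p (R z x)) / ln (op_norm p (R z)))"
  assume "\<not> 1 \<le> local_exponent p T x"
  then obtain y where y: "local_exponent p T x < y" "y < 1" using dense not_le by metis
  from y(1) have ev: "\<forall>\<^sub>F z in at 0. ?f z < y"
    unfolding local_exponent_def by (rule Limsup_lessD)
  obtain r :: real where r: "0 < r" "r < 1" "y \<le> ereal r"
  proof (cases y)
    case (real s)
    then show ?thesis using y by (intro that[of "max s (1/2)"]) (auto simp: one_ereal_def)
  qed (use y that[of "1/2"] in auto)
  define \<epsilon> where "\<epsilon> = (1 - r) / 4"
  have \<epsilon>: "0 < \<epsilon>" "\<epsilon> < 1" using r by (auto simp: \<epsilon>_def)
  have "r * (1 + \<epsilon>) < 1 - \<epsilon>"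
  proof -
    have "r * \<epsilon> < \<epsilon>" using r \<epsilon> by simp
    moreover have "r = 1 - 4 * \<epsilon>" by (simp add: \<epsilon>_def field_simps)
    ultimately show ?thesis using \<epsilon>(1) unfolding distrib_left by linarith
  qed
  then have rlt: "r < (1 - \<epsilon>) / (1 + \<epsilon>)" using \<epsilon> by (simp add: pos_less_divide_eq)
  have "\<exists>\<^sub>F z in at 0. y < ?f z"
  proof (rule frequently_mono[OF _ log_ratio_frequently_large[OF x \<epsilon>]], intro allI impI)
    fix z assume "(1 - \<epsilon>) / (1 + \<epsilon>) \<le> ln (lp_norm p (R z x)) / ln (op_norm p (R z))"
    then have "ereal r < ereal (ln (lp_norm p (R z x)) / ln (op_norm p (R z)))" using rlt by simp
    then show "y < ?f z" using r(3) by (rule le_less_trans[rotated])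
  qed
  moreover have "\<forall>\<^sub>F z in at 0. \<not> y < ?f z"
    using ev by (rule eventually_mono) auto
  ultimately show False unfolding frequently_def by blast
qed

lemma power_set_eq: "power_set p T = {1}"
proof -
  have "local_exponent p T x = 1" if "x \<in> lp p" "x \<noteq> (\<lambda>_. 0)" for x
    using local_exponent_le_1[OF that] local_exponent_ge_1[OF that] by (rule antisym)
  then show ?thesis
    unfolding power_set_def using basis_vec_lp[of 0] basis_vec_nonzero[of 0] by force
qed

end

theorem corollary2p7:
  fixes p :: real
    and w :: "nat \<Rightarrow> complex"
    and T :: "(nat \<Rightarrow> complex) \<Rightarrow> (nat \<Rightarrow> complex)"
  assumes "1 \<le> p"
    and "forward_weighted_shift p w T"
    and "strictly_cyclic p T"
    and "quasinilpotent p T"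
  shows "power_set p T = {1}"
proof -
  obtain x\<^sub>0 where "x\<^sub>0 \<in> lp p" "{A x\<^sub>0 | A. A \<in> wot_closed_algebra p T} = lp p"
    using assms(3) by (auto simp: strictly_cyclic_def)
  then interpret strictly_cyclic_shift p w T x\<^sub>0
    using assms by unfold_locales auto
  show ?thesis by (rule power_set_eq)
qed

end
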